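(* Let $T$ be a Markov–Rényi map associated with $\{I_n\}_{n\in\mathbb N}$, with parameter $\gamma>1$ and repeller $\Lambda$. Let $\psi:\mathbb{N}\to\mathbb{R}_{>0}$ be a function satisfying $\psi(n)/n\to\infty$ as $n\to\infty$. For $\alpha\in[0,\infty]$ let $J_\psi(\alpha)$ be the set of $x\in\Lambda$ for which the limit $\lim_{n\to\infty}\frac{1}{\psi(n)}\log|(T^n)'(x)|$ exists and equals $\alpha$, and let $F_\psi(\alpha)=\dim_{\rm H}J_\psi(\alpha)$. Put $\beta_\psi=\limsup_{n\to\infty}\frac{\psi(n+1)}{\psi(n)}$ and $B_\psi=\limsup_{n\to\infty}\sqrt[n]{\psi(n)}$. Then: (i) when $\alpha=0$, the level set $J_\psi(0)$ has Lebesgue measure $\sum_{n\in\mathbb N}|I_n|$; in particular $F_\psi(0)=1$; (ii) when $0<\alpha<\infty$, the level set $J_\psi(\alpha)$ is nonempty if and only if $\psi$ is equivalent to an increasing function, and in this case $$F_\psi(\alpha)=\frac{1}{(\gamma-1)\beta_\psi+1};$$ (iii) when $\alpha=\infty$, $$F_\psi(\infty)=\frac{1}{(\gamma-1)B_\psi+1}.$$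
   Context: $\mathbb N=\{1,2,3,\dots\}$, $I=[0,1]$; $|A|$ is the diameter of $A\subseteq\mathbb R$; $\dim_{\rm H}$ is Hausdorff dimension. Markov–Rényi map: let $\{I_n\}_{n\in\mathbb N}$ be a collection of disjoint open subintervals of $[0,1]$. A piecewise differentiable interval map $T:\bigcup_{n}\overline{I}_n\to[0,1]$ is a Markov–Rényi map associated with $\{I_n\}$ if: (1) for every $n$, $I_n$ and $I_{n+1}$ share a common endpoint, i.e. $\partial I_n\cap\partial I_{n+1}$ is a singleton; (2) for every $n$, $T|_{I_n}$ extends to a $C^1$ diffeomorphism $T_n$ on an open neighborhood of $\overline I_n$; (3) there exist $p\in\bigcup_n\overline I_n$ and $m\in\mathbb N$ such that $T(p)=p$, $|T'(p)|\ge1$ and $|(T^m)'(x)|>1$ for all $x\in\bigcup_n\overline I_n\setminus\{p\}$; (4) $\overline{T(I_n)}=[0,1]$ for every $n$; (5) there exist constants $\gamma>1$ and $C>1$ such that $C^{-1}n^\gamma\le|T_n'(x)|\le Cn^\gamma$ for all $n\in\mathbb N$, $x\in\overline I_n$. Let $I^*=\bigcup_n\overline I_n$ (a subinterval of $[0,1]$), let $\mathcal Q=\bigcup_{k=0}^\infty T^{-k}\big(\{0,1\}\cup\bigcup_n\partial I_n\big)$ (a countable set), and define the repeller of $T$ as $\Lambda=I^*\setminus\mathcal Q$. Two functions $f,g:\mathbb N\to\mathbb R_{>0}$ are equivalent if $f(n)/g(n)\to1$ as $n\to\infty$. "Increasing" means $\varphi(n+1)\ge\varphi(n)$ for all $n$.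 Convention: $1/\infty=0$, so the formulas give $0$ when $\beta_\psi=\infty$ or $B_\psi=\infty$.
   Formalization: Part (i) additionally assumes that all iterates of T are defined on the repeller Λ (automatic when the closure of I* is [0,1]); if I* leaves a gap in [0,1], a set of positive measure escapes and the measure claim fails. *)

theory Defs
  imports "HOL-Analysis.Analysis"
begin

section \<open>Hausdorff dimension\<close>

definition hausdorff_premeasure :: "real \<Rightarrow> real \<Rightarrow> 'a::metric_space set \<Rightarrow> ennreal" where
  "hausdorff_premeasure \<delta> s A =
     (INF U\<in>{U :: nat \<Rightarrow> 'a set. A \<subseteq> (\<Union>i. U i) \<and> (\<forall>i. bounded (U i) \<and> diameter (U i) \<le> \<delta>)}.
        \<Sum>i. ennreal (diameter (U i) powr s))"

definition hausdorff_outer_measure :: "real \<Rightarrow> 'a::metric_space set \<Rightarrow> ennreal" where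
  "hausdorff_outer_measure s A = (SUP \<delta>\<in>{0<..}. hausdorff_premeasure \<delta> s A)"

text \<open>Only exponents \<open>s > 0\<close> are used: this does not change the infimum, and it avoids the
  value \<open>0 powr 0 = 0\<close>. In particular the empty set has dimension 0.\<close>

definition hausdorff_dim :: "'a::metric_space set \<Rightarrow> ereal" where
  "hausdorff_dim A = Inf {ereal s |s. 0 < s \<and> hausdorff_outer_measure s A = 0}"


section \<open>Markov--Renyi maps\<close>

text \<open>The index set of the intervals is \<open>{1, 2, 3, \<dots>}\<close>; the value \<open>I 0\<close> is never used.
  The map is defined on the union of the closed intervals only. It is represented by a total
  function whose values elsewhere are irrelevant, so every iterate below comes with the
  requirement that the orbit has not left this domain.\<close>

definition mr_domain :: "(nat \<Rightarrow> real set) \<Rightarrow> real set" where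
  "mr_domain I = (\<Union>n\<in>{1..}. closure (I n))"

definition C1_diffeomorphism_on :: "(real \<Rightarrow> real) \<Rightarrow> real set \<Rightarrow> bool" where
  "C1_diffeomorphism_on f U \<longleftrightarrow>
     f C1_differentiable_on U \<and> inj_on f U \<and>
     open (f ` U) \<and> the_inv_into U f C1_differentiable_on (f ` U)"

text \<open>At an endpoint shared by two of the intervals, \<open>T\<close> takes the value of one of the branches
  \<open>S n\<close>, and its derivative is the one of a branch. The next predicate says that \<open>D\<close> is a value
  of the derivative of \<open>T ^^ m\<close> at \<open>x\<close> obtained by the chain rule from branches agreeing with
  \<open>T\<close> along the orbit. It is unique unless the orbit meets a shared endpoint at which both
  branches take the same value, and no such \<open>D\<close> exists if \<open>T ^^ m\<close> is not defined at \<open>x\<close>.\<close>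

definition branch_deriv ::
  "(nat \<Rightarrow> real set) \<Rightarrow> (real \<Rightarrow> real) \<Rightarrow> (nat \<Rightarrow> real \<Rightarrow> real) \<Rightarrow> nat \<Rightarrow> real \<Rightarrow> real \<Rightarrow> bool" where
  "branch_deriv I T S m x D \<longleftrightarrow>
     (\<exists>\<nu> :: nat \<Rightarrow> nat.
        (\<forall>j<m. \<nu> j \<ge> 1 \<and> (T ^^ j) x \<in> closure (I (\<nu> j)) \<and>
               (T ^^ Suc j) x = S (\<nu> j) ((T ^^ j) x)) \<and>
        D = (\<Prod>j<m. deriv (S (\<nu> j)) ((T ^^ j) x)))"

definition markov_renyi :: "(nat \<Rightarrow> real set) \<Rightarrow> (real \<Rightarrow> real) \<Rightarrow> real \<Rightarrow> bool" where
  "markov_renyi I T \<gamma> \<longleftrightarrow>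
     (\<forall>n\<ge>1. \<exists>a b. a < b \<and> I n = {a<..<b} \<and> I n \<subseteq> {0..1}) \<and>
     disjoint_family_on I {1..} \<and>
     T ` mr_domain I \<subseteq> {0..1} \<and>
     (\<forall>n\<ge>1. \<exists>z. frontier (I n) \<inter> frontier (I (n + 1)) = {z}) \<and>
     (\<forall>n\<ge>1. closure (T ` I n) = {0..1}) \<and>
     \<gamma> > 1 \<and>
     (\<exists>S :: nat \<Rightarrow> real \<Rightarrow> real.
        (\<forall>n\<ge>1. \<exists>U. open U \<and> closure (I n) \<subseteq> U \<and> C1_diffeomorphism_on (S n) U) \<and>
        (\<forall>n\<ge>1. \<forall>x\<in>I n. T x = S n x) \<and>
        (\<forall>x\<in>mr_domain I. \<exists>n\<ge>1. x \<in> closure (I n) \<and> T x = S n x) \<and>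
        (\<exists>p\<in>mr_domain I. \<exists>m\<ge>1. T p = p \<and>
           (\<forall>D. branch_deriv I T S 1 p D \<longrightarrow> \<bar>D\<bar> \<ge> 1) \<and>
           (\<forall>x\<in>mr_domain I - {p}. \<forall>D. branch_deriv I T S m x D \<longrightarrow> \<bar>D\<bar> > 1)) \<and>
        (\<exists>C>1. \<forall>n\<ge>1. \<forall>x\<in>closure (I n).
           inverse C * real n powr \<gamma> \<le> \<bar>deriv (S n) x\<bar> \<and>
           \<bar>deriv (S n) x\<bar> \<le> C * real n powr \<gamma>))"

definition exceptional_set :: "(nat \<Rightarrow> real set) \<Rightarrow> (real \<Rightarrow> real) \<Rightarrow> real set" where
  "exceptional_set I T =
     (\<Union>k. {x. (\<forall>j<k. (T ^^ j) x \<in> mr_domain I) \<and>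
              (T ^^ k) x \<in> {0, 1} \<union> (\<Union>n\<in>{1..}. frontier (I n))})"

definition repeller :: "(nat \<Rightarrow> real set) \<Rightarrow> (real \<Rightarrow> real) \<Rightarrow> real set" where
  "repeller I T = mr_domain I - exceptional_set I T"

text \<open>All iterates are defined on the repeller. If the intervals leave a gap in \<open>{0..1}\<close>
  this fails, because each branch maps some points of the repeller into the gap.\<close>

definition iterates_defined_on_repeller :: "(nat \<Rightarrow> real set) \<Rightarrow> (real \<Rightarrow> real) \<Rightarrow> bool" where
  "iterates_defined_on_repeller I T \<longleftrightarrow> (\<forall>x\<in>repeller I T. \<forall>n. (T ^^ n) x \<in> mr_domain I)"

text \<open>A point of the repeller whose orbit stays in the domain visits only the open intervals.
  Hence every \<open>T ^^ n\<close> is differentiable there, with non-zero derivative, and \<open>deriv\<close> and \<open>ln\<close>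
  have their usual meaning.\<close>

definition level_set ::
  "(nat \<Rightarrow> real set) \<Rightarrow> (real \<Rightarrow> real) \<Rightarrow> (nat \<Rightarrow> real) \<Rightarrow> ereal \<Rightarrow> real set" where
  "level_set I T \<psi> \<alpha> =
     {x \<in> repeller I T. (\<forall>n. (T ^^ n) x \<in> mr_domain I) \<and>
        (\<lambda>n. ereal (1 / \<psi> n * ln \<bar>deriv (T ^^ n) x\<bar>)) \<longlonglongrightarrow> \<alpha>}"


section \<open>Growth of the scaling function\<close>

definition equivalent_to_increasing :: "(nat \<Rightarrow> real) \<Rightarrow> bool" where
  "equivalent_to_increasing \<psi> \<longleftrightarrow>
     (\<exists>\<phi> :: nat \<Rightarrow> real. (\<forall>n\<ge>1. \<phi> n > 0) \<and> (\<forall>n\<ge>1. \<phi> (n + 1) \<ge> \<phi> n) \<and>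
        (\<lambda>n. \<psi> n / \<phi> n) \<longlonglongrightarrow> 1)"

definition growth_beta :: "(nat \<Rightarrow> real) \<Rightarrow> ereal" where
  "growth_beta \<psi> = limsup (\<lambda>n. ereal (\<psi> (n + 1) / \<psi> n))"

definition growth_B :: "(nat \<Rightarrow> real) \<Rightarrow> ereal" where
  "growth_B \<psi> = limsup (\<lambda>n. ereal (root n (\<psi> n)))"

end

theory Submission
  imports Defs "HOL-Library.Nat_Bijection"
begin

text \<open>On the repeller, \<open>log |(T^n)'(x)|\<close> differs from \<open>\<gamma>\<close> times \<open>Lam x n\<close>, the sum of the
  logarithms of the first \<open>n\<close> digits, by \<open>O(n)\<close>. Since \<open>\<psi>(n)/n \<rightarrow> \<infinity>\<close> this error is negligible, and
  neither bounded distortion nor the expansion condition on \<open>T\<close> is needed: a cylinder of a word \<open>w\<close> of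
  length \<open>n\<close> with product of digits \<open>P\<close> has length between \<open>C^-n P^-\<gamma>\<close> and \<open>C^n P^-\<gamma>\<close>.

  Upper bounds: points of the level sets have \<open>Lam x (n+1) \<ge> b Lam x n\<close> for infinitely many \<open>n\<close>,
  for every \<open>b\<close> below \<open>\<beta>\<close> (or \<open>B\<close>), and \<open>Lam x n / n \<rightarrow> \<infinity>\<close>. Such points are covered by the sets of all
  points of a cylinder whose next digit is at least \<open>P^(b-1)\<close>, of length
  \<open>O(C^n P^(-1-b(\<gamma>-1)))\<close>; as \<open>P\<close> is superexponentially large, the sum of the \<open>s\<close>-th powers tends to
  zero as soon as \<open>s (1 + b(\<gamma>-1)) > 1\<close>. With \<open>s = 1\<close> and whole cylinders the same sum, a Borel--Cantelli
  argument, shows that \<open>Lam x n = o(\<psi>(n))\<close> almost everywhere.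

  Lower bounds: let the \<open>n\<close>-th digit range over \<open>{N n..<2 * N n}\<close>, where \<open>log (N n)\<close> is about
  \<open>\<alpha>/\<gamma>\<close> times the \<open>n\<close>-th increment of \<open>\<psi>\<close>. The number of cylinders of this Cantor set met by an
  interval gives the mass distribution principle. The level set at infinity contains the level set of
  \<open>b^n\<close> at 1, for every \<open>b > B\<close>.\<close>

section \<open>Hausdorff null sets\<close>

lemma hausdorff_nullI:
  fixes A :: "'a::metric_space set"
  assumes s: "0 < s"
    and cover: "\<And>e. 0 < e \<Longrightarrow> \<exists>U :: nat \<Rightarrow> 'a set. A \<subseteq> (\<Union>i. U i) \<and> (\<forall>i. bounded (U i)) \<and>
                  (\<Sum>i. ennreal (diameter (U i) powr s)) \<le> ennreal e"
  shows "hausdorff_outer_measure s A = 0"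
proof -
  have "hausdorff_premeasure \<delta> s A = 0" if \<delta>: "\<delta> > 0" for \<delta>
  proof -
    have "hausdorff_premeasure \<delta> s A \<le> 0 + ennreal e" if e: "e > 0" for e
    proof -
      have "min e (\<delta> powr s) > 0" using e \<delta> by simp
      from cover[OF this] obtain U :: "nat \<Rightarrow> 'a set" where U: "A \<subseteq> (\<Union>i. U i)" "\<And>i. bounded (U i)"
        "(\<Sum>i. ennreal (diameter (U i) powr s)) \<le> ennreal (min e (\<delta> powr s))" by blast
      have "diameter (U i) \<le> \<delta>" for i
      proof (rule ccontr)
        assume "\<not> diameter (U i) \<le> \<delta>"
        then have "\<delta> powr s < diameter (U i) powr s" using \<delta> s by (intro powr_less_mono2) auto
        moreover have "ennreal (diameter (U i) powr s) \<le> (\<Sum>i. ennreal (diameter (U i) powr s))"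
        proof -
          have "(\<Sum>j\<in>{i}. ennreal (diameter (U j) powr s)) \<le> (\<Sum>i. ennreal (diameter (U i) powr s))"
            by (rule sum_le_suminf) auto
          then show ?thesis by (simp only: sum.insert sum.empty finite.intros empty_iff not_False_eq_True add_0_right)
        qed
        then have "ennreal (diameter (U i) powr s) \<le> ennreal (min e (\<delta> powr s))"
          using U(3) by (rule order_trans)
        then have "diameter (U i) powr s \<le> min e (\<delta> powr s)"
          by (subst (asm) ennreal_le_iff) (use e in simp_all)
        ultimately show False by simp
      qed
      then have "hausdorff_premeasure \<delta> s A \<le> (\<Sum>i. ennreal (diameter (U i) powr s))"
        unfolding hausdorff_premeasure_def using U by (intro INF_lower) auto
      also have "\<dots> \<le> ennreal e" using U(3) by (rule order_trans) (simp add: ennreal_leI)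
      finally show ?thesis by simp
    qed
    then have "hausdorff_premeasure \<delta> s A \<le> 0" by (rule ennreal_le_epsilon)
    then show ?thesis by simp
  qed
  then show ?thesis unfolding hausdorff_outer_measure_def by (intro SUP_eq_const) auto
qed

lemma hausdorff_nullD:
  fixes A :: "'a::metric_space set"
  assumes "hausdorff_outer_measure s A = 0" "\<delta> > 0" "e > 0"
  shows "\<exists>U :: nat \<Rightarrow> 'a set. A \<subseteq> (\<Union>i. U i) \<and> (\<forall>i. bounded (U i) \<and> diameter (U i) \<le> \<delta>) \<and>
            (\<Sum>i. ennreal (diameter (U i) powr s)) < ennreal e"
proof -
  have "hausdorff_premeasure \<delta> s A \<le> hausdorff_outer_measure s A"
    unfolding hausdorff_outer_measure_def using assms by (intro SUP_upper) auto
  then have "hausdorff_premeasure \<delta> s A < ennreal e" using assms by (simp add: le_zero_eq)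
  then show ?thesis unfolding hausdorff_premeasure_def INF_less_iff by blast
qed

lemma hausdorff_null_subset:
  fixes A :: "'a::metric_space set"
  assumes "hausdorff_outer_measure s B = 0" "A \<subseteq> B" "0 < s"
  shows "hausdorff_outer_measure s A = 0"
proof (rule hausdorff_nullI)
  fix e :: real assume "e > 0"
  from hausdorff_nullD[OF assms(1) zero_less_one this]
  show "\<exists>U :: nat \<Rightarrow> 'a set. A \<subseteq> (\<Union>i. U i) \<and> (\<forall>i. bounded (U i)) \<and>
                  (\<Sum>i. ennreal (diameter (U i) powr s)) \<le> ennreal e"
    using assms(2) by (meson less_imp_le order_trans)
qed (use assms in auto)

text \<open>For \<open>s \<le> 1\<close> and a diameter \<open>d \<le> 1\<close>,
  \<open>d \<le> d powr s\<close>. So a cover with small sum of powers has small total length once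
  each set is enclosed in a closed ball whose radius is its diameter.\<close>

lemma hausdorff_null_imp_negligible:
  fixes A :: "real set"
  assumes "hausdorff_outer_measure s A = 0" "0 < s" "s \<le> 1"
  shows "negligible A"
  unfolding negligible_outer
proof (intro allI impI)
  fix e :: real assume e: "e > 0"
  then have "e / 4 > 0" by simp
  from hausdorff_nullD[OF assms(1) zero_less_one this] obtain U :: "nat \<Rightarrow> real set" where
    U: "A \<subseteq> (\<Union>i. U i)" "\<And>i. bounded (U i)" "\<And>i. diameter (U i) \<le> 1"
       "(\<Sum>i. ennreal (diameter (U i) powr s)) < ennreal (e / 4)" by blast
  define V where "V i = (if U i = {} then {} else cball (SOME x. x \<in> U i) (diameter (U i)))" for i
  have UV: "U i \<subseteq> V i" for i
  proof
    fix x assume x: "x \<in> U i"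
    then have "(SOME x. x \<in> U i) \<in> U i" by (rule someI)
    with x show "x \<in> V i" using diameter_bounded_bound[OF U(2)[of i]] unfolding V_def by auto
  qed
  have Vm: "V i \<in> sets lebesgue" for i unfolding V_def by auto
  have em: "emeasure lebesgue (V i) \<le> 2 * ennreal (diameter (U i) powr s)" for i
  proof (cases "U i = {}")
    case True then show ?thesis by (simp add: V_def)
  next
    case False
    have d0: "0 \<le> diameter (U i)" by (rule diameter_ge_0[OF U(2)])
    have "diameter (U i) \<le> diameter (U i) powr s"
    proof (cases "diameter (U i) = 0")
      case False
      then have "diameter (U i) powr 1 \<le> diameter (U i) powr s"
        using d0 U(3)[of i] assms by (intro powr_mono') auto
      then show ?thesis using d0 False by simp
    qed simp
    then have "2 * diameter (U i) \<le> 2 * diameter (U i) powr s" by simp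
    then have "ennreal (2 * diameter (U i)) \<le> ennreal (2 * diameter (U i) powr s)" by (rule ennreal_leI)
    moreover have "emeasure lebesgue (V i) = ennreal (2 * diameter (U i))"
      using False d0 unfolding V_def by (simp add: cball_eq_atLeastAtMost)
    ultimately show ?thesis by (simp add: ennreal_mult)
  qed
  have "emeasure lebesgue (\<Union>i. V i) \<le> (\<Sum>i. emeasure lebesgue (V i))"
    using Vm by (intro emeasure_subadditive_countably) auto
  also have "\<dots> \<le> (\<Sum>i. 2 * ennreal (diameter (U i) powr s))"
    by (intro suminf_le em) auto
  also have "\<dots> = 2 * (\<Sum>i. ennreal (diameter (U i) powr s))" by simp
  also have "\<dots> \<le> 2 * ennreal (e / 4)" using U(4) by (intro mult_left_mono) auto
  also have "\<dots> = ennreal (e / 2)" using e by (simp flip: ennreal_numeral ennreal_mult)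
  finally have le: "emeasure lebesgue (\<Union>i. V i) \<le> ennreal (e / 2)" .
  have "(\<Union>i. V i) \<in> lmeasurable" using Vm le
    by (intro fmeasurableI) (auto simp: less_top[symmetric] top_unique)
  moreover have "measure lebesgue (\<Union>i. V i) \<le> e / 2" using le e
    by (metis (no_types) enn2real_leI half_gt_zero less_imp_le measure_def)
  moreover have "A \<subseteq> (\<Union>i. V i)" using U(1) UV by blast
  ultimately show "\<exists>T. A \<subseteq> T \<and> T \<in> lmeasurable \<and> measure lebesgue T < e"
    using e by (intro exI[of _ "\<Union>i. V i"]) auto
qed

text \<open>Splitting off the first letter factors the weight of a word, and Tonelli for counting
  measures gives one more factor per letter. Integrals over \<open>count_space\<close> allow summing
  over words without fixing an enumeration.\<close>

lemma nn_integral_words: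
  fixes h :: "'a \<Rightarrow> ennreal"
  shows "(\<integral>\<^sup>+w. (if length w = n then prod_list (map h w) else 0) \<partial>count_space UNIV) =
         (\<integral>\<^sup>+a. h a \<partial>count_space UNIV) ^ n"
proof (induction n)
  case 0
  have "(\<integral>\<^sup>+w. (if length w = 0 then prod_list (map h w) else 0) \<partial>count_space UNIV) =
        (\<integral>\<^sup>+w. (indicator {[] :: 'a list} w :: ennreal) \<partial>count_space UNIV)"
    by (rule nn_integral_cong) (auto simp: indicator_def)
  then show ?case by simp
next
  case (Suc n)
  let ?f = "\<lambda>n w. (if length w = n then prod_list (map h w) else 0)"
  have bij: "bij_betw (\<lambda>(a, w). a # w) UNIV {w :: 'a list. w \<noteq> []}"
    by (auto simp: bij_betw_def inj_on_def image_iff neq_Nil_conv)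
  have "(\<integral>\<^sup>+w. ?f (Suc n) w \<partial>count_space UNIV) = (\<integral>\<^sup>+w. ?f (Suc n) w \<partial>count_space {w. w \<noteq> []})"
    by (subst nn_integral_count_space_indicator, simp, intro nn_integral_cong) (auto simp: indicator_def)
  also have "\<dots> = (\<integral>\<^sup>+z. ?f (Suc n) (case z of (a, w) \<Rightarrow> a # w) \<partial>count_space UNIV)"
    by (rule nn_integral_bij_count_space[OF bij, symmetric])
  also have "\<dots> = (\<integral>\<^sup>+z. h (fst z) * ?f n (snd z) \<partial>count_space UNIV)"
    by (intro nn_integral_cong) auto
  also have "\<dots> = (\<integral>\<^sup>+a. \<integral>\<^sup>+w. h a * ?f n w \<partial>count_space UNIV \<partial>count_space UNIV)"
    by (subst nn_integral_fst_count_space[symmetric]) (simp cong: if_cong)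
  also have "\<dots> = (\<integral>\<^sup>+a. h a \<partial>count_space UNIV) * (\<integral>\<^sup>+w. ?f n w \<partial>count_space UNIV)"
    by (simp add: nn_integral_cmult nn_integral_multc)
  finally show ?case using Suc by simp
qed

section \<open>Covers indexed by words of digits\<close>

definition word_prod :: "nat list \<Rightarrow> real" where
  "word_prod w = prod_list (map real w)"

lemma word_prod_simps [simp]: "word_prod [] = 1" "word_prod (a # w) = real a * word_prod w"
  "word_prod (v @ w) = word_prod v * word_prod w"
  by (auto simp: word_prod_def)

lemma word_prod_ge_1: "0 \<notin> set w \<Longrightarrow> 1 \<le> word_prod w"
proof (induction w)
  case (Cons a w)
  then have "1 * 1 \<le> real a * word_prod w" by (intro mult_mono) auto
  then show ?case by simp
qed simp

lemma word_prod_pos: "0 \<notin> set w \<Longrightarrow> 0 < word_prod w"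
  using word_prod_ge_1[of w] by simp

lemma prod_list_ennreal_powr:
  "prod_list (map (\<lambda>a. ennreal (real a powr u)) w) = ennreal (word_prod w powr u)"
proof (induction w)
  case (Cons a w)
  have "0 \<le> word_prod w" by (induction w) auto
  then show ?case using Cons by (simp add: ennreal_mult powr_mult)
qed simp

text \<open>A Borel--Cantelli lemma whose threshold \<open>K\<close> does not depend on the sets
  \<open>U w\<close>. Part of the exponent, \<open>v > 0\<close>, is spent on beating
  \<open>R ^ n\<close> through \<open>exp (K * n) \<le> word_prod w\<close>; the rest,
  \<open>u > 1\<close>, keeps the sum over letters finite. Words of length \<open>n\<close> then
  contribute at most \<open>c * (1/2) ^ n\<close>.\<close>

lemma hausdorff_null_words:
  assumes s: "0 < s" and t: "1 < t" and R: "0 < R" and c: "0 < c"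
  shows "\<exists>K. \<forall>U :: nat list \<Rightarrow> 'a::metric_space set.
     (\<forall>w. 0 \<notin> set w \<longrightarrow> bounded (U w) \<and> diameter (U w) powr s \<le> c * R ^ length w * word_prod w powr - t) \<longrightarrow>
     hausdorff_outer_measure s {x. \<exists>\<^sub>F n in sequentially. \<exists>w. length w = n \<and> 0 \<notin> set w \<and>
        exp (K * real n) \<le> word_prod w \<and> x \<in> U w} = 0"
proof -
  define v where "v = (t - 1) / 2"
  define u where "u = (t + 1) / 2"
  have v: "v > 0" and u: "u > 1" and uv: "t = u + v" using t by (auto simp: v_def u_def field_simps)
  \<comment> \<open>Since \<open>0 powr - u = 0\<close>, the letter 0 contributes nothing: this is
    the Riemann zeta function at \<open>u\<close>, and the sums below may run over all
    words.\<close>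
  define \<zeta> where "\<zeta> = (\<Sum>a. real a powr - u)"
  have sm: "summable (\<lambda>a. real a powr - u)" using u by (simp add: summable_real_powr_iff)
  have "\<zeta> \<ge> (\<Sum>a\<in>{1}. real a powr - u)" unfolding \<zeta>_def by (rule sum_le_suminf[OF sm]) auto
  then have z: "\<zeta> \<ge> 1" by simp
  have zeta: "(\<integral>\<^sup>+a. ennreal (real a powr - u) \<partial>count_space UNIV) = ennreal \<zeta>"
    unfolding \<zeta>_def nn_integral_count_space_nat using sm by (intro suminf_ennreal2) auto
  \<comment> \<open>Chosen so that \<open>exp (- (K * v))\<close> cancels one factor
    \<open>R\<close> and one factor \<open>\<zeta>\<close> per letter and leaves
    \<open>1/2\<close>.\<close>
  define K where "K = ln (2 * R * \<zeta>) / v"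
  have pos: "2 * R * \<zeta> > 0" using R z by simp
  have eK: "exp (- (K * v)) = 1 / (2 * R * \<zeta>)"
    using pos v by (simp add: K_def exp_minus field_simps)
  show ?thesis
  proof (intro exI[of _ K] allI impI)
    fix U :: "nat list \<Rightarrow> 'a::metric_space set"
    assume U: "\<forall>w. 0 \<notin> set w \<longrightarrow> bounded (U w) \<and> diameter (U w) powr s \<le> c * R ^ length w * word_prod w powr - t"
    let ?A = "{x. \<exists>\<^sub>F n in sequentially. \<exists>w. length w = n \<and> 0 \<notin> set w \<and>
        exp (K * real n) \<le> word_prod w \<and> x \<in> U w}"
    show "hausdorff_outer_measure s ?A = 0"
    proof (rule hausdorff_nullI[OF s])
      fix e :: real assume e: "e > 0"
      \<comment> \<open>The lengths from \<open>m\<close> on contribute at most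
        \<open>2 * c * (1/2) ^ m < e\<close>.\<close>
      obtain m where m: "(1/2::real) ^ m < e / (2 * c)" 
        using real_arch_pow_inv[of "e / (2 * c)" "1/2"] e c by auto
      define G where "G w \<longleftrightarrow> m \<le> length w \<and> 0 \<notin> set w \<and> exp (K * real (length w)) \<le> word_prod w" for w
      define V where "V w = (if G w then U w else {})" for w
      \<comment> \<open>The bound is written as a series in \<open>n\<close> with at most one
        non-zero term, so that summation over words and over lengths can be exchanged.\<close>
      have point: "ennreal (diameter (V w) powr s) \<le>
          (\<Sum>n. (if m \<le> n then ennreal (c * (1 / (2 * \<zeta>)) ^ n) else 0) *
               (if length w = n then prod_list (map (\<lambda>a. ennreal (real a powr - u)) w) else 0))"
        (is "_ \<le> ?S w") for w
      proof (cases "G w")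
        case True
        let ?n = "length w" and ?P = "word_prod w"
        have P: "?P > 0" using True by (auto simp: G_def intro: word_prod_pos)
        have "diameter (V w) powr s \<le> c * R ^ ?n * ?P powr - t"
          using U True by (auto simp: V_def G_def)
        also have "?P powr - t = ?P powr - v * ?P powr - u" by (simp add: uv powr_add[symmetric] algebra_simps)
        also have "?P powr - v \<le> exp (K * real ?n) powr - v"
          using True v P by (intro powr_mono2') (auto simp: G_def)
        also have "exp (K * real ?n) powr - v = exp (- (K * v)) ^ ?n"
          by (simp add: powr_def exp_of_nat_mult[symmetric] mult_ac)
        also have "c * R ^ ?n * (exp (- (K * v)) ^ ?n * ?P powr - u) = c * (1 / (2 * \<zeta>)) ^ ?n * ?P powr - u"
          using R by (simp add: eK power_divide power_mult_distrib)
        finally have "diameter (V w) powr s \<le> c * (1 / (2 * \<zeta>)) ^ ?n * ?P powr - u"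
          using c R P by (simp add: mult_left_mono mult_right_mono)
        then have "ennreal (diameter (V w) powr s) \<le> ennreal (c * (1 / (2 * \<zeta>)) ^ ?n) * ennreal (?P powr - u)"
          using c z by (subst ennreal_mult[symmetric]) (auto intro!: ennreal_leI)
        also have "\<dots> = (\<Sum>n\<in>{?n}. (if m \<le> n then ennreal (c * (1 / (2 * \<zeta>)) ^ n) else 0) *
               (if length w = n then prod_list (map (\<lambda>a. ennreal (real a powr - u)) w) else 0))"
          using True by (simp add: G_def prod_list_ennreal_powr)
        also have "\<dots> \<le> ?S w" by (rule sum_le_suminf) auto
        finally show ?thesis .
      qed (simp add: V_def)
      have "(\<Sum>i. ennreal (diameter (V (list_decode i)) powr s)) =
            (\<integral>\<^sup>+i. ennreal (diameter (V (list_decode i)) powr s) \<partial>count_space UNIV)"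
        by (simp add: nn_integral_count_space_nat)
      also have "\<dots> = (\<integral>\<^sup>+w. ennreal (diameter (V w) powr s) \<partial>count_space UNIV)"
        by (rule nn_integral_bij_count_space) (rule bij_list_decode)
      also have "\<dots> \<le> (\<integral>\<^sup>+w. ?S w \<partial>count_space UNIV)" by (intro nn_integral_mono point)
      also have "\<dots> = (\<Sum>n. (if m \<le> n then ennreal (c * (1 / (2 * \<zeta>)) ^ n) else 0) * ennreal \<zeta> ^ n)"
        by (subst nn_integral_suminf) (auto simp: nn_integral_cmult nn_integral_words zeta)
      also have "\<dots> \<le> (\<Sum>n. ennreal (c * (1/2) ^ m * (if m \<le> n then (1/2) ^ (n - m) else 0)))"
      proof (intro suminf_le)
        fix n
        show "(if m \<le> n then ennreal (c * (1 / (2 * \<zeta>)) ^ n) else 0) * ennreal \<zeta> ^ n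
            \<le> ennreal (c * (1/2) ^ m * (if m \<le> n then (1/2) ^ (n - m) else 0))"
        proof (cases "m \<le> n")
          case True
          have "c * (1 / (2 * \<zeta>)) ^ n * \<zeta> ^ n = c * (1/2) ^ m * (1/2) ^ (n - m)"
            using True z by (simp add: power_add[symmetric] power_divide power_mult_distrib)
          then show ?thesis using True c z by (simp add: ennreal_power flip: ennreal_mult)
        qed simp
      qed auto
      also have "\<dots> = ennreal (c * (1/2) ^ m * 2)"
      proof (rule suminf_ennreal_eq)
        have "(\<lambda>n. (1/2::real) ^ n) sums 2" using geometric_sums[of "1/2::real"] by simp
        then have "(\<lambda>n. (if m \<le> n + m then (1/2::real) ^ (n + m - m) else 0)) sums 2" by simp
        then have "(\<lambda>n. (if m \<le> n then (1/2::real) ^ (n - m) else 0)) sums 2"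
          by (subst (asm) sums_iff_shift) simp
        then show "(\<lambda>n. c * (1/2) ^ m * (if m \<le> n then (1/2) ^ (n - m) else 0)) sums (c * (1/2) ^ m * 2)"
          by (rule sums_mult)
      qed (use c in auto)
      also have "\<dots> \<le> ennreal e" using m c by (intro ennreal_leI) (simp add: field_simps)
      finally have S: "(\<Sum>i. ennreal (diameter (V (list_decode i)) powr s)) \<le> ennreal e" .
      have "?A \<subseteq> (\<Union>i. V (list_decode i))"
      proof
        fix x assume "x \<in> ?A"
        then obtain w where w: "length w \<ge> m" "0 \<notin> set w" "exp (K * real (length w)) \<le> word_prod w" "x \<in> U w"
          unfolding mem_Collect_eq frequently_sequentially by blast
        then have "x \<in> V (list_decode (list_encode w))" by (simp add: V_def G_def)
        then show "x \<in> (\<Union>i. V (list_decode i))" by blast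
      qed
      moreover have "bounded (V (list_decode i))" for i using U by (auto simp: V_def G_def)
      ultimately show "\<exists>U :: nat \<Rightarrow> 'a set. ?A \<subseteq> (\<Union>i. U i) \<and> (\<forall>i. bounded (U i)) \<and>
                  (\<Sum>i. ennreal (diameter (U i) powr s)) \<le> ennreal e"
        using S by (intro exI[of _ "\<lambda>i. V (list_decode i)"]) auto
    qed
  qed
qed

section \<open>Inverse branches and cylinders\<close>

text \<open>By strict monotonicity, interior points have values strictly between \<open>f a\<close>
  and \<open>f b\<close>, so the extreme values \<open>c\<close> and \<open>d\<close> are attained
  only at the endpoints.\<close>

lemma continuous_inj_open_image:
  fixes f :: "real \<Rightarrow> real"
  assumes ab: "a < b" and cont: "continuous_on {a..b} f" and inj: "inj_on f {a..b}"
    and img: "f ` {a..b} = {c..d}"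
  shows "f ` {a<..<b} = {c<..<d}"
proof -
  have cd: "c \<le> d" using img ab by (metis atLeastAtMost_iff atLeastatMost_empty_iff image_is_empty less_imp_le)
  have inner: "f x \<in> {c<..<d}" if "a < x" "x < b" for x
  proof -
    have "f a \<in> {c..d}" "f b \<in> {c..d}" using img ab by auto
    with continuous_inj_imp_mono[OF that cont inj] show ?thesis by auto
  qed
  obtain u where u: "u \<in> {a..b}" "f u = c" using img cd by (metis atLeastAtMost_iff imageE order_refl)
  obtain v where v: "v \<in> {a..b}" "f v = d" using img cd by (metis atLeastAtMost_iff imageE order_refl)
  have "u \<in> {a, b}" "v \<in> {a, b}"
    using inner[of u] inner[of v] u v by force+
  have "c \<noteq> d"
  proof
    assume "c = d"
    then have "f a = f b" using img ab by (metis atLeastAtMost_iff atLeastAtMost_singleton imageI insert_iff less_imp_le order_refl singletonD)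
    with inj ab show False by (auto dest: inj_onD)
  qed
  then have "u \<noteq> v" using u v by auto
  then have ends: "{f a, f b} = {c, d}" using \<open>u \<in> {a, b}\<close> \<open>v \<in> {a, b}\<close> u v by auto
  show ?thesis
  proof (intro equalityI subsetI)
    fix y assume y: "y \<in> {c<..<d}"
    then obtain x where x: "x \<in> {a..b}" "y = f x" using img by (metis greaterThanLessThan_subseteq_atLeastAtMost_iff imageE order_refl subsetD)
    then have "x \<noteq> a" "x \<noteq> b" using y ends by (auto simp: doubleton_eq_iff)
    then show "y \<in> f ` {a<..<b}" using x by auto
  qed (use inner in auto)
qed

text \<open>The form of the map used from here on: endpoints are explicit, and each branch maps the
  closed interval onto \<open>{0..1}\<close>, so that inverse branches are defined at 0 and 1 as
  well and can be composed freely.\<close>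

locale renyi_branches =
  fixes I :: "nat \<Rightarrow> real set" and T :: "real \<Rightarrow> real" and S :: "nat \<Rightarrow> real \<Rightarrow> real"
    and l r :: "nat \<Rightarrow> real" and \<gamma> C :: real
  assumes gamma: "\<gamma> > 1" and C: "C > 1"
    and I_eq: "n \<ge> 1 \<Longrightarrow> I n = {l n<..<r n}"
    and lr: "n \<ge> 1 \<Longrightarrow> l n < r n" and l0: "n \<ge> 1 \<Longrightarrow> 0 \<le> l n" and r1: "n \<ge> 1 \<Longrightarrow> r n \<le> 1"
    and disj: "m \<ge> 1 \<Longrightarrow> n \<ge> 1 \<Longrightarrow> m \<noteq> n \<Longrightarrow> I m \<inter> I n = {}"
    and adjacent: "n \<ge> 1 \<Longrightarrow> \<exists>z. {l n, r n} \<inter> {l (n + 1), r (n + 1)} = {z}"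
    and T_eq: "n \<ge> 1 \<Longrightarrow> x \<in> I n \<Longrightarrow> T x = S n x"
    and S_deriv: "n \<ge> 1 \<Longrightarrow> x \<in> {l n..r n} \<Longrightarrow> (S n has_real_derivative deriv (S n) x) (at x)"
    and S_inj: "n \<ge> 1 \<Longrightarrow> inj_on (S n) {l n..r n}"
    and S_image: "n \<ge> 1 \<Longrightarrow> S n ` {l n..r n} = {0..1}"
    and deriv_lower: "n \<ge> 1 \<Longrightarrow> x \<in> {l n..r n} \<Longrightarrow> real n powr \<gamma> / C \<le> \<bar>deriv (S n) x\<bar>"
    and deriv_upper: "n \<ge> 1 \<Longrightarrow> x \<in> {l n..r n} \<Longrightarrow> \<bar>deriv (S n) x\<bar> \<le> C * real n powr \<gamma>"

lemma markov_renyi_branches: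
  assumes "markov_renyi I T \<gamma>"
  shows "\<exists>S l r C. renyi_branches I T S l r \<gamma> C"
proof -
  define l where "l n = Inf (I n)" for n
  define r where "r n = Sup (I n)" for n
  have "l n < r n \<and> I n = {l n<..<r n} \<and> I n \<subseteq> {0..1}" if "n \<ge> 1" for n
  proof -
    from assms have "\<forall>n\<ge>1. \<exists>a b. a < b \<and> I n = {a<..<b} \<and> I n \<subseteq> {0..1}"
      unfolding markov_renyi_def by (rule conjunct1)
    with that obtain a b where "a < b" "I n = {a<..<b}" "I n \<subseteq> {0..1}" by blast
    then show ?thesis by (simp add: l_def r_def)
  qed
  then have lr: "\<And>n. n \<ge> 1 \<Longrightarrow> l n < r n" "\<And>n. n \<ge> 1 \<Longrightarrow> I n = {l n<..<r n}"
    "\<And>n. n \<ge> 1 \<Longrightarrow> I n \<subseteq> {0..1}" by blast+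
  have cl: "closure (I n) = {l n..r n}" and fr: "frontier (I n) = {l n, r n}" if "n \<ge> 1" for n
    using lr[OF that] by (auto simp: frontier_def)
  note M = assms[unfolded markov_renyi_def, THEN conjunct2]
  have g: "\<gamma> > 1" and d: "disjoint_family_on I {1..}"
    and a': "\<forall>n\<ge>1. \<exists>z. frontier (I n) \<inter> frontier (I (n + 1)) = {z}"
    and full': "\<forall>n\<ge>1. closure (T ` I n) = {0..1}"
    by (rule M[THEN conjunct2, THEN conjunct2, THEN conjunct2, THEN conjunct2, THEN conjunct1]
        M[THEN conjunct1] M[THEN conjunct2, THEN conjunct2, THEN conjunct1]
        M[THEN conjunct2, THEN conjunct2, THEN conjunct2, THEN conjunct1])+
  from a' have a: "\<exists>z. frontier (I n) \<inter> frontier (I (n + 1)) = {z}" if "n \<ge> 1" for n using that by blast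
  from full' have full: "closure (T ` I n) = {0..1}" if "n \<ge> 1" for n using that by blast
  from M[THEN conjunct2, THEN conjunct2, THEN conjunct2, THEN conjunct2, THEN conjunct2] obtain S C where
    S1: "\<forall>n\<ge>1. \<exists>U. open U \<and> closure (I n) \<subseteq> U \<and> C1_diffeomorphism_on (S n) U"
    and S2: "\<forall>n\<ge>1. \<forall>x\<in>I n. T x = S n x" and C1: "C > 1"
    and C2: "\<forall>n\<ge>1. \<forall>x\<in>closure (I n). inverse C * real n powr \<gamma> \<le> \<bar>deriv (S n) x\<bar> \<and>
           \<bar>deriv (S n) x\<bar> \<le> C * real n powr \<gamma>"
    by (elim conjE exE) (rule that)
  note S = S1[rule_format] S2[rule_format] and C = C1 C2[rule_format]
  have sub: "{l n<..<r n} \<subseteq> {0..1}" if "n \<ge> 1" for n using lr[OF that] by auto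
  have der: "(S n has_real_derivative deriv (S n) x) (at x)" if n: "n \<ge> 1" and x: "x \<in> {l n..r n}" for n x
  proof -
    from S(1)[OF n] obtain U where U: "open U" "closure (I n) \<subseteq> U" "S n C1_differentiable_on U"
      unfolding C1_diffeomorphism_on_def by blast
    then have "(S n has_vector_derivative vector_derivative (S n) (at x)) (at x)"
      using x cl[OF n] by (auto simp: C1_differentiable_on_eq vector_derivative_works)
    then show ?thesis
      by (metis DERIV_imp_deriv has_real_derivative_iff_has_vector_derivative)
  qed
  have inj: "inj_on (S n) {l n..r n}" if n: "n \<ge> 1" for n
    using S(1)[OF n] cl[OF n] unfolding C1_diffeomorphism_on_def by (metis inj_on_subset)
  \<comment> \<open>The image condition is about \<open>T\<close> on the open interval, where it
    coincides with \<open>S n\<close>. The image of the closed interval is closed and, by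
    continuity, contained in the closure of the image of the open one, hence equal to it.\<close>
  have img: "S n ` {l n..r n} = {0..1}" if n: "n \<ge> 1" for n
  proof -
    have cont: "continuous_on {l n..r n} (S n)"
      using der[OF n] by (meson DERIV_continuous_on has_field_derivative_at_within)
    have TS: "T ` I n = S n ` I n" using S(2)[OF n] by (rule image_cong[OF refl])
    have "closed (S n ` {l n..r n})" using cont by (intro compact_imp_closed compact_continuous_image) auto
    moreover have "S n ` I n \<subseteq> S n ` {l n..r n}" using lr[OF n] by auto
    ultimately have "closure (S n ` I n) \<subseteq> S n ` {l n..r n}" by (simp add: closure_minimal)
    moreover have "S n ` {l n..r n} \<subseteq> closure (S n ` I n)"
      using image_closure_subset[of "I n" "S n" "closure (S n ` I n)"] cont cl[OF n]
      by (simp add: closure_subset)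
    ultimately show ?thesis using full[OF n] TS by simp
  qed
  have "renyi_branches I T S l r \<gamma> C"
  proof
    fix n :: nat assume n: "n \<ge> 1"
    show "0 \<le> l n" "r n \<le> 1" using greaterThanLessThan_subseteq_atLeastAtMost_iff[of "l n" "r n" 0 1] sub[OF n] lr(1)[OF n] by auto
    show "\<exists>z. {l n, r n} \<inter> {l (n + 1), r (n + 1)} = {z}" using a[OF n] fr[OF n] fr[of "n + 1"] by simp
  next
    fix n x assume "(n::nat) \<ge> 1" "x \<in> {l n..r n}"
    then show "real n powr \<gamma> / C \<le> \<bar>deriv (S n) x\<bar>" "\<bar>deriv (S n) x\<bar> \<le> C * real n powr \<gamma>"
      using C(2)[of n x] cl[of n] by (auto simp: field_simps)
  next
    fix m n assume "(m::nat) \<ge> 1" "(n::nat) \<ge> 1" "m \<noteq> n"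
    then show "I m \<inter> I n = {}" using d by (auto simp: disjoint_family_on_def)
  qed (use g C lr S der inj img in auto)
  then show ?thesis by blast
qed

context renyi_branches
begin

lemma S_image_open: "n \<ge> 1 \<Longrightarrow> S n ` {l n<..<r n} = {0<..<1}"
  by (intro continuous_inj_open_image lr S_inj S_image DERIV_continuous_on[of _ _ "deriv (S n)"]
      has_field_derivative_at_within[OF S_deriv]) auto

text \<open>These are the inverse branches. \<open>foldr g w\<close> composes them along the word
  \<open>w\<close> and maps \<open>{0..1}\<close> onto the closed cylinder of
  \<open>w\<close>.\<close>

definition g :: "nat \<Rightarrow> real \<Rightarrow> real" where
  "g n = inv_into {l n..r n} (S n)"

lemma g_in: "n \<ge> 1 \<Longrightarrow> y \<in> {0..1} \<Longrightarrow> g n y \<in> {l n..r n}"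
  unfolding g_def using S_image by (intro inv_into_into) auto

lemma S_g: "n \<ge> 1 \<Longrightarrow> y \<in> {0..1} \<Longrightarrow> S n (g n y) = y"
  unfolding g_def using S_image by (intro f_inv_into_f) auto

lemma g_S: "n \<ge> 1 \<Longrightarrow> x \<in> {l n..r n} \<Longrightarrow> g n (S n x) = x"
  unfolding g_def using S_inj by (intro inv_into_f_f) auto

lemma g_open: assumes "n \<ge> 1" "y \<in> {0<..<1}" shows "g n y \<in> I n"
proof -
  obtain x where "x \<in> {l n<..<r n}" "y = S n x" using S_image_open assms by blast
  then show ?thesis using g_S[of n x] I_eq assms by auto
qed

lemma I_subset: "n \<ge> 1 \<Longrightarrow> I n \<subseteq> {0<..<1}"
  using I_eq[of n] l0[of n] r1[of n] by auto

lemma closed_subset: "n \<ge> 1 \<Longrightarrow> {l n..r n} \<subseteq> {0..1}"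
  using l0[of n] r1[of n] by auto

text \<open>Mean value theorem with the two-sided derivative bound on the closed interval.\<close>

lemma S_dist:
  assumes n: "n \<ge> 1" and "x \<in> {l n..r n}" "y \<in> {l n..r n}"
  shows "real n powr \<gamma> / C * \<bar>x - y\<bar> \<le> \<bar>S n x - S n y\<bar>" "\<bar>S n x - S n y\<bar> \<le> C * real n powr \<gamma> * \<bar>x - y\<bar>"
proof -
  have *: "real n powr \<gamma> / C * \<bar>x - y\<bar> \<le> \<bar>S n x - S n y\<bar> \<and> \<bar>S n x - S n y\<bar> \<le> C * real n powr \<gamma> * \<bar>x - y\<bar>"
    if "x < y" "x \<in> {l n..r n}" "y \<in> {l n..r n}" for x y
  proof -
    have "\<exists>z. x < z \<and> z < y \<and> S n y - S n x = (y - x) * deriv (S n) z"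
      using that by (intro MVT2 S_deriv n) auto
    then obtain z where z': "x < z" "z < y" "S n y - S n x = (y - x) * deriv (S n) z" by blast
    then have z: "z \<in> {l n..r n}" "S n y - S n x = (y - x) * deriv (S n) z" using that by auto
    then have "\<bar>S n x - S n y\<bar> = \<bar>deriv (S n) z\<bar> * \<bar>x - y\<bar>"
      by (metis abs_minus_commute abs_mult mult.commute)
    then show ?thesis
      using mult_right_mono[OF deriv_lower[OF n z(1)], of "\<bar>x - y\<bar>"]
        mult_right_mono[OF deriv_upper[OF n z(1)], of "\<bar>x - y\<bar>"] by simp
  qed
  show "real n powr \<gamma> / C * \<bar>x - y\<bar> \<le> \<bar>S n x - S n y\<bar>"
    using *[of x y] *[of y x] assms by (cases x y rule: linorder_cases) (auto simp: abs_minus_commute)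
  show "\<bar>S n x - S n y\<bar> \<le> C * real n powr \<gamma> * \<bar>x - y\<bar>"
    using *[of x y] *[of y x] assms by (cases x y rule: linorder_cases) (auto simp: abs_minus_commute)
qed

lemma g_dist:
  assumes n: "n \<ge> 1" and "x \<in> {0..1}" "y \<in> {0..1}"
  shows "\<bar>g n x - g n y\<bar> \<le> C * real n powr - \<gamma> * \<bar>x - y\<bar>" "real n powr - \<gamma> / C * \<bar>x - y\<bar> \<le> \<bar>g n x - g n y\<bar>"
proof -
  have "real n powr \<gamma> > 0" using n by simp
  with S_dist[OF n g_in[OF n assms(2)] g_in[OF n assms(3)]] S_g[OF n] assms C
  show "\<bar>g n x - g n y\<bar> \<le> C * real n powr - \<gamma> * \<bar>x - y\<bar>" "real n powr - \<gamma> / C * \<bar>x - y\<bar> \<le> \<bar>g n x - g n y\<bar>"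
    by (auto simp: powr_minus field_simps)
qed

lemma words_in: "0 \<notin> set w \<Longrightarrow> y \<in> {0..1} \<Longrightarrow> foldr g w y \<in> {0..1}"
proof (induction w)
  case (Cons a w)
  then have "a \<ge> 1" by (cases a) auto
  then show ?case using g_in[of a "foldr g w y"] closed_subset[of a] Cons by auto
qed simp

lemma words_open: "0 \<notin> set w \<Longrightarrow> y \<in> {0<..<1} \<Longrightarrow> foldr g w y \<in> {0<..<1}"
proof (induction w)
  case (Cons a w)
  then have "a \<ge> 1" by (cases a) auto
  then show ?case using g_open[of a "foldr g w y"] I_subset[of a] Cons by auto
qed simp

text \<open>A letter \<open>a\<close> contributes a factor between
  \<open>a powr - \<gamma> / C\<close> and \<open>C * a powr - \<gamma>\<close>. The constants are
  simply multiplied, a loss that is only exponential in the length of the word.\<close>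

lemma words_dist:
  assumes "0 \<notin> set w" "x \<in> {0..1}" "y \<in> {0..1}"
  shows "\<bar>foldr g w x - foldr g w y\<bar> \<le> C ^ length w * word_prod w powr - \<gamma> * \<bar>x - y\<bar>"
    and "word_prod w powr - \<gamma> / C ^ length w * \<bar>x - y\<bar> \<le> \<bar>foldr g w x - foldr g w y\<bar>"
  using assms
proof (induction w)
  case (Cons a w)
  { case 1
    then have a: "a \<ge> 1" and P: "word_prod w > 0" by (auto intro: word_prod_pos simp: Suc_le_eq)
    note g = g_dist[OF a words_in words_in, of w x w y]
    have "\<bar>foldr g (a # w) x - foldr g (a # w) y\<bar> \<le> C * real a powr - \<gamma> * \<bar>foldr g w x - foldr g w y\<bar>"
      using g(1) 1 by auto
    also have "\<dots> \<le> C * real a powr - \<gamma> * (C ^ length w * word_prod w powr - \<gamma> * \<bar>x - y\<bar>)"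
      using Cons.IH(1) 1 C by (intro mult_left_mono) auto
    finally show ?case using P by (simp add: powr_mult mult_ac) }
  { case 2
    then have a: "a \<ge> 1" and P: "word_prod w > 0" by (auto intro: word_prod_pos simp: Suc_le_eq)
    note g = g_dist[OF a words_in words_in, of w x w y]
    have "word_prod (a # w) powr - \<gamma> / C ^ length (a # w) * \<bar>x - y\<bar> =
        real a powr - \<gamma> / C * (word_prod w powr - \<gamma> / C ^ length w * \<bar>x - y\<bar>)"
      using P by (simp add: powr_mult)
    also have "\<dots> \<le> real a powr - \<gamma> / C * \<bar>foldr g w x - foldr g w y\<bar>"
      using Cons.IH(2) 2 C by (intro mult_left_mono) auto
    also have "\<dots> \<le> \<bar>foldr g (a # w) x - foldr g (a # w) y\<bar>"
      using g(2) 2 by auto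
    finally show ?case . }
qed simp_all

section \<open>Geometry of the partition\<close>

text \<open>Consecutive intervals share an endpoint, so one can walk from interval \<open>a\<close>
  to interval \<open>b\<close> through these common points and spend at most the length of each
  interval passed.\<close>

lemma chain_dist:
  assumes "1 \<le> a" "a \<le> b" "x \<in> {l a..r a}" "y \<in> {l b..r b}"
  shows "\<bar>x - y\<bar> \<le> (\<Sum>j=a..b. r j - l j)"
  using assms(2,4)
proof (induction b arbitrary: y rule: dec_induct)
  case base
  then show ?case using assms by auto
next
  case (step b)
  obtain z where "z \<in> {l b, r b}" "z \<in> {l (Suc b), r (Suc b)}"
    using adjacent[of b] step assms by auto
  then have z: "z \<in> {l b..r b}" "z \<in> {l (Suc b)..r (Suc b)}"
    using lr[of b] lr[of "Suc b"] step assms by auto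
  have "\<bar>x - y\<bar> \<le> \<bar>x - z\<bar> + \<bar>z - y\<bar>" by simp
  also have "\<bar>x - z\<bar> \<le> (\<Sum>j=a..b. r j - l j)" using step z by auto
  also have "\<bar>z - y\<bar> \<le> r (Suc b) - l (Suc b)" using z step by auto
  finally show ?case using step by simp
qed

lemma length_upper:
  assumes n: "n \<ge> 1" shows "r n - l n \<le> C * real n powr - \<gamma>"
proof -
  have "S n (r n) \<in> {0..1}" "S n (l n) \<in> {0..1}" using S_image[OF n] lr[OF n] by auto
  then have "\<bar>S n (r n) - S n (l n)\<bar> \<le> 1" by auto
  with S_dist(1)[OF n, of "r n" "l n"] lr[OF n] have "real n powr \<gamma> / C * (r n - l n) \<le> 1" by auto
  moreover have "real n powr \<gamma> > 0" using n by simp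
  ultimately show ?thesis using C by (auto simp: powr_minus field_simps)
qed

text \<open>Mean value theorem for the power \<open>1 - \<gamma>\<close> between \<open>n\<close>
  and \<open>n + 1\<close>; the factor \<open>2 powr \<gamma>\<close> comes from
  \<open>n + 1 \<le> 2 * n\<close>. The right-hand side telescopes in
  \<open>tail_length\<close>.\<close>

lemma powr_neg_le_diff:
  assumes "(n::nat) \<ge> 1"
  shows "real n powr - \<gamma> \<le> 2 powr \<gamma> / (\<gamma> - 1) * (real n powr (1 - \<gamma>) - real (Suc n) powr (1 - \<gamma>))"
proof -
  have "\<exists>z. real n < z \<and> z < real (Suc n) \<and> real (Suc n) powr (1 - \<gamma>) - real n powr (1 - \<gamma>) =
      (real (Suc n) - real n) * ((1 - \<gamma>) * z powr (1 - \<gamma> - 1))"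
    using assms by (intro MVT2 has_real_derivative_powr) auto
  then obtain z where z: "real n < z" "z < real (Suc n)"
    "real (Suc n) powr (1 - \<gamma>) - real n powr (1 - \<gamma>) = (1 - \<gamma>) * z powr - \<gamma>" by auto
  have "real n powr - \<gamma> = 2 powr \<gamma> * (2 * real n) powr - \<gamma>"
    by (simp add: powr_mult powr_minus field_simps)
  also have "(2 * real n) powr - \<gamma> \<le> z powr - \<gamma>"
    using z assms gamma by (intro powr_mono2') auto
  also have "z powr - \<gamma> = 1 / (\<gamma> - 1) * (real n powr (1 - \<gamma>) - real (Suc n) powr (1 - \<gamma>))"
    using z(3) gamma by (simp add: field_simps)
  finally show ?thesis by simp
qed

definition Ktail :: real where "Ktail = C * (2 powr \<gamma> / (\<gamma> - 1))"

lemma Ktail_pos: "Ktail > 0"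
  using C gamma by (simp add: Ktail_def)

lemma tail_length:
  assumes "1 \<le> a" "a \<le> b"
  shows "(\<Sum>j=a..b. r j - l j) \<le> Ktail * real a powr (1 - \<gamma>)"
proof -
  have "(\<Sum>j=a..b. r j - l j) \<le> (\<Sum>j=a..b. Ktail * (real j powr (1 - \<gamma>) - real (Suc j) powr (1 - \<gamma>)))"
  proof (rule sum_mono)
    fix j assume "j \<in> {a..b}"
    then have j: "j \<ge> 1" using assms by auto
    have "r j - l j \<le> C * real j powr - \<gamma>" by (rule length_upper[OF j])
    also have "\<dots> \<le> C * (2 powr \<gamma> / (\<gamma> - 1) * (real j powr (1 - \<gamma>) - real (Suc j) powr (1 - \<gamma>)))"
      using powr_neg_le_diff[OF j] C by (intro mult_left_mono) auto
    finally show "r j - l j \<le> Ktail * (real j powr (1 - \<gamma>) - real (Suc j) powr (1 - \<gamma>))"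
      by (simp add: Ktail_def)
  qed
  also have "\<dots> = Ktail * (real a powr (1 - \<gamma>) - real (Suc b) powr (1 - \<gamma>))"
    using assms sum_Suc_diff[of a b "\<lambda>j. - (real j powr (1 - \<gamma>))"]
    by (simp add: sum_distrib_left[symmetric])
  also have "\<dots> \<le> Ktail * real a powr (1 - \<gamma>)" using Ktail_pos by (intro mult_left_mono) auto
  finally show ?thesis .
qed

text \<open>Two points are joined by the chain of intervals starting at the smaller index, whose
  total length is bounded by \<open>tail_length\<close>. The threshold \<open>N\<close> is real
  because it will be a power of a product of digits.\<close>

lemma tail_dist:
  assumes "0 < N" "1 \<le> a" "N \<le> real a" "x \<in> {l a..r a}" "1 \<le> b" "N \<le> real b" "y \<in> {l b..r b}"
  shows "\<bar>x - y\<bar> \<le> Ktail * N powr (1 - \<gamma>)"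
proof -
  have *: "\<bar>x - y\<bar> \<le> Ktail * N powr (1 - \<gamma>)" if "1 \<le> a" "a \<le> b" "N \<le> real a" "x \<in> {l a..r a}" "y \<in> {l b..r b}" for x y a b
  proof -
    have "\<bar>x - y\<bar> \<le> Ktail * real a powr (1 - \<gamma>)"
      using chain_dist[of a b x y] tail_length[of a b] that by linarith
    also have "\<dots> \<le> Ktail * N powr (1 - \<gamma>)"
      using Ktail_pos that assms(1) gamma by (intro mult_left_mono powr_mono2') auto
    finally show ?thesis .
  qed
  show ?thesis using *[of a b x y] *[of b a y x] assms by (cases "a \<le> b") (auto simp: abs_minus_commute)
qed

text \<open>The disjoint neighbours \<open>n - 1\<close> and \<open>n + 1\<close> cannot touch
  interval \<open>n\<close> at the same endpoint, so it lies between them, away from 0 and 1. Hence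
  \<open>g n\<close> with \<open>n \<ge> 2\<close> sends even the points 0 and 1 into the open unit
  interval.\<close>

lemma inner_closed:
  assumes n: "n \<ge> 2" shows "{l n..r n} \<subseteq> {0<..<1}"
proof -
  have dis: "\<not> (l m < x \<and> x < r m \<and> l k < x \<and> x < r k)" if "m \<ge> 1" "k \<ge> 1" "m \<noteq> k" for m k x
    using disj[OF that] I_eq[OF that(1)] I_eq[OF that(2)] by auto
  have ll: "l m \<noteq> l k" if "m \<ge> 1" "k \<ge> 1" "m \<noteq> k" for m k
  proof
    assume eq: "l m = l k"
    have "l m < min (r m) (r k)" using lr[OF that(1)] lr[OF that(2)] eq by simp
    from dense[OF this] obtain x where "l m < x" "x < min (r m) (r k)" by blast
    then show False using dis[OF that, of x] eq by auto
  qed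
  have rr: "r m \<noteq> r k" if "m \<ge> 1" "k \<ge> 1" "m \<noteq> k" for m k
  proof
    assume eq: "r m = r k"
    have "max (l m) (l k) < r m" using lr[OF that(1)] lr[OF that(2)] eq by simp
    from dense[OF this] obtain x where "max (l m) (l k) < x" "x < r m" by blast
    then show False using dis[OF that, of x] eq by auto
  qed
  obtain k where k: "n = Suc k" "k \<ge> 1" using n by (cases n) auto
  have less: "l k < r k" "l n < r n" "l (Suc n) < r (Suc n)" using lr k by auto
  \<comment> \<open>Disjointness excludes a common left or a common right endpoint, so the shared
    point is a left end of one interval and a right end of the other.\<close>
  have touch: "l m = r (Suc m) \<or> r m = l (Suc m)" if m: "m \<ge> 1" for m
  proof -
    obtain z where "{l m, r m} \<inter> {l (Suc m), r (Suc m)} = {z}" using adjacent[OF m] by (auto simp only: Suc_eq_plus1)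
    then have "z \<in> {l m, r m}" "z \<in> {l (Suc m), r (Suc m)}" by blast+
    moreover have "l m \<noteq> l (Suc m)" by (rule ll) (use m in simp_all)
    moreover have "r m \<noteq> r (Suc m)" by (rule rr) (use m in simp_all)
    ultimately show ?thesis by (elim insertE emptyE) simp_all
  qed
  have "l n = r (Suc n) \<or> r n = l (Suc n)" using touch[of n] n by simp
  moreover have "l k = r n \<or> r k = l n" using touch[of k] k by simp
  moreover have "l k \<noteq> l (Suc n)" by (rule ll) (use k in simp_all)
  moreover have "r k \<noteq> r (Suc n)" by (rule rr) (use k in simp_all)
  moreover have "0 \<le> l k" "r k \<le> 1" "0 \<le> l (Suc n)" "r (Suc n) \<le> 1"
    using k by (auto intro: l0 r1)
  ultimately have "l n > 0 \<and> r n < 1" using less by linarith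
  then show ?thesis by auto
qed

end

section \<open>Digits and level sets\<close>

lemma linear_over_scale_tendsto_0:
  assumes "filterlim (\<lambda>n. \<psi> n / real n) at_top sequentially"
  shows "(\<lambda>n. c * real n / \<psi> n) \<longlonglongrightarrow> 0"
proof -
  have "(\<lambda>n. inverse (\<psi> n / real n)) \<longlonglongrightarrow> 0"
    using assms by (rule tendsto_inverse_0_at_top)
  then have "(\<lambda>n. c * inverse (\<psi> n / real n)) \<longlonglongrightarrow> c * 0" by (intro tendsto_intros)
  then show ?thesis by simp
qed

context renyi_branches
begin

lemma frontier_I: "n \<ge> 1 \<Longrightarrow> frontier (I n) = {l n, r n}"
  using I_eq[of n] lr[of n] by (auto simp: frontier_def)

lemma open_I: "n \<ge> 1 \<Longrightarrow> open (I n)"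
  using I_eq[of n] by simp

lemma I_not_frontier: assumes "n \<ge> 1" "m \<ge> 1" "x \<in> I n" shows "x \<notin> frontier (I m)"
proof (cases "m = n")
  case True
  then show ?thesis using assms I_eq[of n] frontier_I[of n] by auto
next
  case False
  then have "I n \<inter> closure (I m) = {}"
    using disj[of m n] assms open_I[of n] by (metis inf_commute open_Int_closure_eq_empty)
  then show ?thesis using assms by (auto simp: frontier_def)
qed

text \<open>Along such orbits \<open>T\<close> is differentiable and the digits are unambiguous;
  \<open>good_eq\<close> relates this set to the repeller.\<close>

definition good :: "real set" where
  "good = {x. \<forall>n. \<exists>a\<ge>1. (T ^^ n) x \<in> I a}"

definition digit :: "real \<Rightarrow> nat \<Rightarrow> nat" where
  "digit x n = (SOME a. a \<ge> 1 \<and> (T ^^ n) x \<in> I a)"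

lemma digit: assumes "x \<in> good" shows "digit x n \<ge> 1" "(T ^^ n) x \<in> I (digit x n)"
proof -
  have "\<exists>a. a \<ge> 1 \<and> (T ^^ n) x \<in> I a" using assms by (auto simp: good_def)
  then have "digit x n \<ge> 1 \<and> (T ^^ n) x \<in> I (digit x n)" unfolding digit_def by (rule someI_ex)
  then show "digit x n \<ge> 1" "(T ^^ n) x \<in> I (digit x n)" by auto
qed

lemma digit_unique: assumes "x \<in> good" "a \<ge> 1" "(T ^^ n) x \<in> I a" shows "digit x n = a"
  using digit[OF assms(1), of n] disj[of a "digit x n"] assms by auto

text \<open>A point of a closed interval that is not an endpoint lies in the open one. Conversely,
  an open interval contains neither 0 nor 1 nor an endpoint of any of the intervals.\<close>

lemma good_eq: "good = {x \<in> repeller I T. \<forall>n. (T ^^ n) x \<in> mr_domain I}"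
proof (intro equalityI subsetI CollectI conjI allI)
  fix x assume x: "x \<in> good"
  show dom: "(T ^^ n) x \<in> mr_domain I" for n
    using digit[OF x, of n] closure_subset[of "I (digit x n)"] unfolding mr_domain_def by auto
  have "(T ^^ n) x \<notin> {0, 1} \<union> (\<Union>n\<in>{1..}. frontier (I n))" for n
    using digit[OF x, of n] I_subset[of "digit x n"] I_not_frontier[of "digit x n"] by auto
  then show "x \<in> repeller I T" using dom[of 0] unfolding repeller_def exceptional_set_def by auto
next
  fix x assume x: "x \<in> {x \<in> repeller I T. \<forall>n. (T ^^ n) x \<in> mr_domain I}"
  have "\<exists>a\<ge>1. (T ^^ n) x \<in> I a" for n
  proof -
    obtain a where a: "a \<ge> 1" "(T ^^ n) x \<in> closure (I a)" using x unfolding mr_domain_def by auto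
    moreover have "(T ^^ n) x \<notin> frontier (I a)" using x a unfolding repeller_def exceptional_set_def by auto
    ultimately show ?thesis using interior_open[OF open_I[OF a(1)]] by (auto simp: frontier_def)
  qed
  then show "x \<in> good" by (simp add: good_def)
qed

lemma good_in: "x \<in> good \<Longrightarrow> (T ^^ n) x \<in> {0<..<1}"
  using digit[of x n] I_subset[of "digit x n"] by auto

definition word :: "real \<Rightarrow> nat \<Rightarrow> nat list" where
  "word x n = map (digit x) [0..<n]"

lemma word_Suc: "word x (Suc n) = word x n @ [digit x n]"
  by (simp add: word_def)

lemma length_word [simp]: "length (word x n) = n"
  by (simp add: word_def)

lemma word_pos: assumes "x \<in> good" shows "0 \<notin> set (word x n)"
proof
  assume "0 \<in> set (word x n)"
  then obtain j where "digit x j = 0" unfolding word_def by auto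
  with digit(1)[OF assms, of j] show False by simp
qed

lemma orbit_eq_g: assumes "x \<in> good" shows "(T ^^ n) x = g (digit x n) ((T ^^ Suc n) x)"
  using digit[OF assms, of n] T_eq[of "digit x n" "(T ^^ n) x"] I_eq[of "digit x n"]
    g_S[of "digit x n" "(T ^^ n) x"] by auto

lemma good_word: assumes "x \<in> good" shows "x = foldr g (word x n) ((T ^^ n) x)"
proof (induction n)
  case (Suc n)
  then show ?case using orbit_eq_g[OF assms, of n] by (simp add: word_Suc del: funpow.simps)
qed (simp add: word_def)

definition Lam :: "real \<Rightarrow> nat \<Rightarrow> real" where
  "Lam x n = (\<Sum>j<n. ln (real (digit x j)))"

lemma Lam_Suc: "Lam x (Suc n) = Lam x n + ln (real (digit x n))"
  by (simp add: Lam_def)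

lemma Lam_mono: "x \<in> good \<Longrightarrow> Lam x n \<le> Lam x (Suc n)"
  using digit(1)[of x n] by (simp add: Lam_Suc)

lemma Lam_nonneg: "x \<in> good \<Longrightarrow> 0 \<le> Lam x n"
  unfolding Lam_def using digit(1)[of x] by (intro sum_nonneg) auto

lemma word_prod_word: assumes "x \<in> good" shows "word_prod (word x n) = exp (Lam x n)"
proof (induction n)
  case (Suc n)
  then show ?case using digit(1)[OF assms, of n] by (simp add: word_Suc Lam_Suc exp_add)
qed (simp add: word_def Lam_def)

text \<open>Chain rule: \<open>T\<close> agrees with a branch on an open neighbourhood of each orbit
  point and so has the derivative of that branch there.\<close>

lemma deriv_iterate:
  assumes "x \<in> good"
  shows "((T ^^ n) has_real_derivative (\<Prod>j<n. deriv (S (digit x j)) ((T ^^ j) x))) (at x)"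
proof (induction n)
  case 0
  then show ?case by (simp add: id_def)
next
  case (Suc n)
  let ?a = "digit x n" and ?y = "(T ^^ n) x"
  note d = digit[OF assms, of n]
  have "(S ?a has_real_derivative deriv (S ?a) ?y) (at ?y)"
    using d I_eq[OF d(1)] by (intro S_deriv) auto
  then have "(T has_real_derivative deriv (S ?a) ?y) (at ?y)"
    by (rule has_field_derivative_transform_within_open[OF _ open_I[OF d(1)] d(2)]) (simp add: T_eq[OF d(1)])
  from DERIV_chain[OF this Suc] show ?case by (simp add: mult.commute comp_def)
qed

text \<open>The logarithm of the derivative is a sum along the orbit, and each term differs from
  \<open>\<gamma>\<close> times the logarithm of the digit by at most \<open>ln C\<close>.\<close>

lemma ln_deriv_bound:
  assumes "x \<in> good"
  shows "\<bar>ln \<bar>deriv (T ^^ n) x\<bar> - \<gamma> * Lam x n\<bar> \<le> real n * ln C"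
proof -
  let ?d = "\<lambda>j. deriv (S (digit x j)) ((T ^^ j) x)"
  have b: "real (digit x j) powr \<gamma> / C \<le> \<bar>?d j\<bar>" "\<bar>?d j\<bar> \<le> C * real (digit x j) powr \<gamma>"
    "real (digit x j) > 0" for j
    using digit[OF assms, of j] I_eq[of "digit x j"] by (auto intro!: deriv_lower deriv_upper)
  have b0: "real (digit x j) powr \<gamma> > 0" for j using b(3)[of j] by simp
  have pos: "\<bar>?d j\<bar> > 0" for j
    using b(1)[of j] b0[of j] C by (smt (verit) divide_pos_pos)
  have 1: "\<bar>ln \<bar>?d j\<bar> - \<gamma> * ln (real (digit x j))\<bar> \<le> ln C" for j
  proof -
    have "ln (real (digit x j) powr \<gamma> / C) \<le> ln \<bar>?d j\<bar>"
      using b(1)[of j] b0[of j] C pos[of j] by (subst ln_le_cancel_iff) auto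
    moreover have "ln \<bar>?d j\<bar> \<le> ln (C * real (digit x j) powr \<gamma>)"
      using b(2)[of j] b0[of j] C pos[of j] by (subst ln_le_cancel_iff) auto
    ultimately show ?thesis using b(3)[of j] b0[of j] C by (simp add: ln_div ln_mult ln_powr abs_le_iff)
  qed
  have "deriv (T ^^ n) x = (\<Prod>j<n. ?d j)" by (rule DERIV_imp_deriv[OF deriv_iterate[OF assms]])
  then have "ln \<bar>deriv (T ^^ n) x\<bar> = (\<Sum>j<n. ln \<bar>?d j\<bar>)"
    using pos by (simp add: abs_prod ln_prod)
  then have eq: "ln \<bar>deriv (T ^^ n) x\<bar> - \<gamma> * Lam x n = (\<Sum>j<n. ln \<bar>?d j\<bar> - \<gamma> * ln (real (digit x j)))"
    by (simp add: Lam_def sum_distrib_left sum_subtractf)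
  have "\<bar>\<Sum>j<n. ln \<bar>?d j\<bar> - \<gamma> * ln (real (digit x j))\<bar> \<le> (\<Sum>j<n. \<bar>ln \<bar>?d j\<bar> - \<gamma> * ln (real (digit x j))\<bar>)" by (rule sum_abs)
  also have "\<dots> \<le> (\<Sum>j<n. ln C)" by (intro sum_mono 1)
  finally show ?thesis unfolding eq by simp
qed

lemma tendsto_error:
  assumes psi: "filterlim (\<lambda>n. \<psi> n / real n) at_top sequentially" and x: "x \<in> good"
  shows "(\<lambda>n. ln \<bar>deriv (T ^^ n) x\<bar> / \<psi> n - \<gamma> * Lam x n / \<psi> n) \<longlonglongrightarrow> 0"
proof (rule Lim_null_comparison)
  have "eventually (\<lambda>n. \<psi> n / real n > 0) sequentially"
    using psi by (simp add: filterlim_at_top_dense)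
  then show "eventually (\<lambda>n. norm (ln \<bar>deriv (T ^^ n) x\<bar> / \<psi> n - \<gamma> * Lam x n / \<psi> n) \<le> ln C * real n / \<psi> n) sequentially"
  proof eventually_elim
    case (elim n)
    then have p: "\<psi> n > 0" by (simp add: zero_less_divide_iff)
    have "norm (ln \<bar>deriv (T ^^ n) x\<bar> / \<psi> n - \<gamma> * Lam x n / \<psi> n) = \<bar>ln \<bar>deriv (T ^^ n) x\<bar> - \<gamma> * Lam x n\<bar> / \<psi> n"
      using p by (simp add: diff_divide_distrib[symmetric])
    also have "\<dots> \<le> (real n * ln C) / \<psi> n"
      using p by (intro divide_right_mono ln_deriv_bound x) auto
    finally show ?case by (simp add: mult.commute)
  qed
  show "(\<lambda>n. ln C * real n / \<psi> n) \<longlonglongrightarrow> 0" by (rule linear_over_scale_tendsto_0[OF psi])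
qed

lemma level_set_real:
  assumes psi: "filterlim (\<lambda>n. \<psi> n / real n) at_top sequentially"
  shows "level_set I T \<psi> (ereal \<alpha>) = {x \<in> good. (\<lambda>n. \<gamma> * Lam x n / \<psi> n) \<longlonglongrightarrow> \<alpha>}"
proof -
  have "(\<lambda>n. ereal (1 / \<psi> n * ln \<bar>deriv (T ^^ n) x\<bar>)) \<longlonglongrightarrow> ereal \<alpha> \<longleftrightarrow> (\<lambda>n. \<gamma> * Lam x n / \<psi> n) \<longlonglongrightarrow> \<alpha>"
    if "x \<in> good" for x
    using Lim_transform_eq[OF tendsto_error[OF psi that]] by simp
  then show ?thesis unfolding level_set_def good_eq by auto
qed

lemma level_set_infinite:
  assumes psi: "filterlim (\<lambda>n. \<psi> n / real n) at_top sequentially"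
  shows "level_set I T \<psi> \<infinity> = {x \<in> good. filterlim (\<lambda>n. \<gamma> * Lam x n / \<psi> n) at_top sequentially}"
proof -
  have "(\<lambda>n. ereal (1 / \<psi> n * ln \<bar>deriv (T ^^ n) x\<bar>)) \<longlonglongrightarrow> \<infinity> \<longleftrightarrow> filterlim (\<lambda>n. \<gamma> * Lam x n / \<psi> n) at_top sequentially"
    if "x \<in> good" for x
  proof -
    note e = tendsto_error[OF psi that]
    have "filterlim (\<lambda>n. ln \<bar>deriv (T ^^ n) x\<bar> / \<psi> n) at_top sequentially \<longleftrightarrow> filterlim (\<lambda>n. \<gamma> * Lam x n / \<psi> n) at_top sequentially"
      using filterlim_tendsto_add_at_top[OF e, of "\<lambda>n. \<gamma> * Lam x n / \<psi> n"]
        filterlim_tendsto_add_at_top[OF tendsto_minus[OF e], of "\<lambda>n. ln \<bar>deriv (T ^^ n) x\<bar> / \<psi> n"] by auto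
    then show ?thesis by (simp add: tendsto_PInfty' tendsto_PInfty_eq_at_top)
  qed
  then show ?thesis unfolding level_set_def good_eq by auto
qed

section \<open>Covering estimates\<close>

text \<open>With \<open>P = exp (Lam x n)\<close>, the product of the first \<open>n\<close> digits,
  the jump condition says that the next digit is at least \<open>P powr (b - 1)\<close>. The points
  of a cylinder with this property form a set whose diameter, raised to the power \<open>s\<close>,
  decays like \<open>P powr - t\<close> with \<open>t > 1\<close>; superlinear growth of
  \<open>Lam\<close> supplies the threshold required by \<open>hausdorff_null_words\<close>.\<close>

lemma dim_upper:
  assumes b: "0 < b" and s: "0 < s" and sb: "1 < s * (1 + b * (\<gamma> - 1))"
  shows "hausdorff_outer_measure s {x \<in> good. (\<forall>K. \<forall>\<^sub>F n in sequentially. K * real n \<le> Lam x n) \<and>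
            (\<exists>\<^sub>F n in sequentially. b * Lam x n \<le> Lam x (Suc n))} = 0" (is "hausdorff_outer_measure s ?A = 0")
proof -
  define t where "t = s * (1 + b * (\<gamma> - 1))"
  define R where "R = C powr s"
  define c where "c = Ktail powr s"
  have "1 < t" "0 < R" "0 < c" using sb C Ktail_pos by (auto simp: t_def R_def c_def)
  from hausdorff_null_words[OF s this, where 'a = real] obtain K where K: "\<And>U :: nat list \<Rightarrow> real set.
     (\<forall>w. 0 \<notin> set w \<longrightarrow> bounded (U w) \<and> diameter (U w) powr s \<le> c * R ^ length w * word_prod w powr - t) \<Longrightarrow>
     hausdorff_outer_measure s {x. \<exists>\<^sub>F n in sequentially. \<exists>w. length w = n \<and> 0 \<notin> set w \<and>
        exp (K * real n) \<le> word_prod w \<and> x \<in> U w} = 0" by blast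
  define U where "U w = foldr g w ` (\<Union>a\<in>{a. a \<ge> 1 \<and> word_prod w powr (b - 1) \<le> real a}. {l a..r a})" for w
  have U: "bounded (U w) \<and> diameter (U w) powr s \<le> c * R ^ length w * word_prod w powr - t" if w: "0 \<notin> set w" for w
  proof -
    let ?P = "word_prod w" let ?d = "C ^ length w * ?P powr - \<gamma> * (Ktail * (?P powr (b - 1)) powr (1 - \<gamma>))"
    have P: "?P > 0" by (rule word_prod_pos[OF w])
    have d0: "?d \<ge> 0" using C Ktail_pos by simp
    have dist: "dist x y \<le> ?d" if "x \<in> U w" "y \<in> U w" for x y
    proof -
      from that obtain x' y' a a' where *: "x = foldr g w x'" "y = foldr g w y'" "a \<ge> 1" "a' \<ge> 1"
        "?P powr (b - 1) \<le> real a" "?P powr (b - 1) \<le> real a'" "x' \<in> {l a..r a}" "y' \<in> {l a'..r a'}"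
        unfolding U_def by blast
      have "x' \<in> {0..1}" "y' \<in> {0..1}" using * closed_subset by blast+
      then have "\<bar>x - y\<bar> \<le> C ^ length w * ?P powr - \<gamma> * \<bar>x' - y'\<bar>"
        unfolding * by (rule words_dist(1)[OF w])
      also have "\<bar>x' - y'\<bar> \<le> Ktail * (?P powr (b - 1)) powr (1 - \<gamma>)"
        by (rule tail_dist[of _ a _ a']) (use * P in auto)
      finally show ?thesis using C by (simp add: dist_real_def mult_left_mono)
    qed
    then have "diameter (U w) \<le> ?d" using d0 by (intro diameter_le) (auto simp: dist_norm)
    moreover have "0 \<le> diameter (U w)" and bd: "bounded (U w)"
      using dist diameter_ge_0[of "U w"] unfolding bounded_two_points by blast+
    ultimately have "diameter (U w) powr s \<le> ?d powr s" using s by (intro powr_mono2) auto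
    \<comment> \<open>The exponents add up: \<open>- \<gamma> + (b - 1) * (1 - \<gamma>) = - (1 + b
      * (\<gamma> - 1))\<close>.\<close>
    also have "?d = Ktail * C ^ length w * ?P powr - (1 + b * (\<gamma> - 1))"
      by (simp add: powr_powr powr_add[symmetric] algebra_simps)
    also have "\<dots> powr s = c * R ^ length w * ?P powr - t"
      using Ktail_pos C P
      by (simp add: powr_mult powr_powr c_def R_def t_def powr_realpow[symmetric] mult_ac algebra_simps del: powr_realpow)
    finally show ?thesis using bd by simp
  qed
  have "hausdorff_outer_measure s {x. \<exists>\<^sub>F n in sequentially. \<exists>w. length w = n \<and> 0 \<notin> set w \<and>
        exp (K * real n) \<le> word_prod w \<and> x \<in> U w} = 0" by (rule K) (use U in blast)
  then show ?thesis
  proof (rule hausdorff_null_subset[OF _ _ s], intro subsetI CollectI)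
    fix x assume x: "x \<in> ?A"
    then have xg: "x \<in> good" by simp
    have "\<forall>\<^sub>F n in sequentially. K * real n \<le> Lam x n" "\<exists>\<^sub>F n in sequentially. b * Lam x n \<le> Lam x (Suc n)"
      using x by auto
    then have "\<exists>\<^sub>F n in sequentially. b * Lam x n \<le> Lam x (Suc n) \<and> K * real n \<le> Lam x n"
      by (simp add: frequently_eventually_frequently)
    then show "\<exists>\<^sub>F n in sequentially. \<exists>w. length w = n \<and> 0 \<notin> set w \<and> exp (K * real n) \<le> word_prod w \<and> x \<in> U w"
    proof (rule frequently_elim1)
      fix n assume n: "b * Lam x n \<le> Lam x (Suc n) \<and> K * real n \<le> Lam x n"
      let ?w = "word x n" and ?a = "digit x n"
      have a: "?a \<ge> 1" by (rule digit[OF xg])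
      have "word_prod ?w powr (b - 1) = exp ((b - 1) * Lam x n)"
        by (simp add: word_prod_word[OF xg] powr_def)
      also have "\<dots> \<le> exp (ln (real ?a))" using n by (simp add: Lam_Suc algebra_simps)
      also have "\<dots> = real ?a" using a by simp
      finally have "word_prod ?w powr (b - 1) \<le> real ?a" .
      moreover have "(T ^^ n) x \<in> {l ?a..r ?a}" using digit[OF xg, of n] I_eq[of ?a] by auto
      ultimately have "x \<in> U ?w" unfolding U_def using a good_word[OF xg, of n] by blast
      then show "\<exists>w. length w = n \<and> 0 \<notin> set w \<and> exp (K * real n) \<le> word_prod w \<and> x \<in> U w"
        using n word_pos[OF xg, of n] by (intro exI[of _ ?w]) (simp add: word_prod_word[OF xg])
    qed
  qed
qed

text \<open>The same argument with whole cylinders, \<open>s = 1\<close> and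
  \<open>t = \<gamma>\<close>. As \<open>\<psi>\<close> outgrows every linear function,
  \<open>e * \<psi> n \<le> Lam x n\<close> passes the threshold \<open>K * n\<close> for large
  \<open>n\<close>.\<close>

lemma large_negligible:
  assumes psi: "filterlim (\<lambda>n. \<psi> n / real n) at_top sequentially" and e: "e > 0"
  shows "negligible {x \<in> good. \<exists>\<^sub>F n in sequentially. e * \<psi> n \<le> Lam x n}"
proof -
  define U where "U w = foldr g w ` {0..1}" for w
  from hausdorff_null_words[of 1 \<gamma> C 1, where 'a = real] gamma C obtain K where K: "\<And>U :: nat list \<Rightarrow> real set.
     (\<forall>w. 0 \<notin> set w \<longrightarrow> bounded (U w) \<and> diameter (U w) powr 1 \<le> 1 * C ^ length w * word_prod w powr - \<gamma>) \<Longrightarrow>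
     hausdorff_outer_measure 1 {x. \<exists>\<^sub>F n in sequentially. \<exists>w. length w = n \<and> 0 \<notin> set w \<and>
        exp (K * real n) \<le> word_prod w \<and> x \<in> U w} = 0" by auto
  have U: "bounded (U w) \<and> diameter (U w) powr 1 \<le> 1 * C ^ length w * word_prod w powr - \<gamma>" if w: "0 \<notin> set w" for w
  proof -
    have dist: "dist x y \<le> C ^ length w * word_prod w powr - \<gamma>" if "x \<in> U w" "y \<in> U w" for x y
    proof -
      from that obtain x' y' where *: "x = foldr g w x'" "y = foldr g w y'" "x' \<in> {0..1}" "y' \<in> {0..1}"
        unfolding U_def by blast
      have "\<bar>x - y\<bar> \<le> C ^ length w * word_prod w powr - \<gamma> * \<bar>x' - y'\<bar>"
        unfolding * by (rule words_dist(1)[OF w *(3,4)])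
      also have "\<dots> \<le> C ^ length w * word_prod w powr - \<gamma> * 1"
        using * C by (intro mult_left_mono) auto
      finally show ?thesis by (simp add: dist_real_def)
    qed
    then have "diameter (U w) \<le> C ^ length w * word_prod w powr - \<gamma>"
      using C by (intro diameter_le) (auto simp: dist_norm)
    moreover have "0 \<le> diameter (U w)" and bd: "bounded (U w)"
      using dist diameter_ge_0[of "U w"] unfolding bounded_two_points by blast+
    ultimately show ?thesis by simp
  qed
  have "hausdorff_outer_measure 1 {x. \<exists>\<^sub>F n in sequentially. \<exists>w. length w = n \<and> 0 \<notin> set w \<and>
        exp (K * real n) \<le> word_prod w \<and> x \<in> U w} = 0" by (rule K) (use U in blast)
  then have "negligible {x. \<exists>\<^sub>F n in sequentially. \<exists>w. length w = n \<and> 0 \<notin> set w \<and>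
        exp (K * real n) \<le> word_prod w \<and> x \<in> U w}" by (rule hausdorff_null_imp_negligible) auto
  then show ?thesis
  proof (rule negligible_subset, intro subsetI CollectI)
    fix x assume x: "x \<in> {x \<in> good. \<exists>\<^sub>F n in sequentially. e * \<psi> n \<le> Lam x n}"
    then have xg: "x \<in> good" and f: "\<exists>\<^sub>F n in sequentially. e * \<psi> n \<le> Lam x n" by auto
    have "\<forall>\<^sub>F n in sequentially. \<psi> n / real n \<ge> K / e" using psi by (simp add: filterlim_at_top)
    then have "\<forall>\<^sub>F n in sequentially. K * real n \<le> e * \<psi> n" using eventually_gt_at_top[of 0]
      by eventually_elim (use e in \<open>simp add: field_simps\<close>)
    with f have "\<exists>\<^sub>F n in sequentially. e * \<psi> n \<le> Lam x n \<and> K * real n \<le> e * \<psi> n"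
      by (simp add: frequently_eventually_frequently)
    then show "\<exists>\<^sub>F n in sequentially. \<exists>w. length w = n \<and> 0 \<notin> set w \<and> exp (K * real n) \<le> word_prod w \<and> x \<in> U w"
    proof (rule frequently_elim1)
      fix n assume n: "e * \<psi> n \<le> Lam x n \<and> K * real n \<le> e * \<psi> n"
      have "(T ^^ n) x \<in> {0..1}" using good_in[OF xg, of n] by auto
      then have "x \<in> U (word x n)" unfolding U_def using good_word[OF xg, of n] by blast
      then show "\<exists>w. length w = n \<and> 0 \<notin> set w \<and> exp (K * real n) \<le> word_prod w \<and> x \<in> U w"
        using n word_pos[OF xg, of n] by (intro exI[of _ "word x n"]) (simp add: word_prod_word[OF xg])
    qed
  qed
qed

end

section \<open>Upper bounds for the dimension\<close>

lemma hausdorff_dim_le: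
  assumes "\<And>s. 0 < s \<Longrightarrow> d < ereal s \<Longrightarrow> hausdorff_outer_measure s A = 0" "0 \<le> d"
  shows "hausdorff_dim A \<le> d"
proof (rule dense_ge)
  fix y assume y: "d < y"
  show "hausdorff_dim A \<le> y"
  proof (cases y)
    case (real s)
    then have "0 < s" using y assms(2) by (metis ereal_less(2) le_less_trans)
    then have "hausdorff_outer_measure s A = 0" using assms(1) y real by simp
    then show ?thesis unfolding hausdorff_dim_def using \<open>0 < s\<close> real by (intro Inf_lower) auto
  qed (use y in auto)
qed

lemma hausdorff_dim_ge:
  assumes "\<And>s. 0 < s \<Longrightarrow> ereal s < d \<Longrightarrow> hausdorff_outer_measure s A \<noteq> 0"
  shows "d \<le> hausdorff_dim A"
  unfolding hausdorff_dim_def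
proof (rule Inf_greatest)
  fix y assume "y \<in> {ereal s |s. 0 < s \<and> hausdorff_outer_measure s A = 0}"
  then show "d \<le> y" using assms not_le by blast
qed

text \<open>Cutting the unit interval into \<open>n\<close> equal pieces gives the sum
  \<open>n powr (1 - s)\<close>, which tends to 0.\<close>

lemma hausdorff_null_unit:
  assumes s: "1 < s" and A: "A \<subseteq> {0..1::real}"
  shows "hausdorff_outer_measure s A = 0"
proof (rule hausdorff_nullI)
  fix e :: real assume e: "e > 0"
  have "(\<lambda>n. real n powr (1 - s)) \<longlonglongrightarrow> 0"
    by (rule tendsto_neg_powr[OF _ filterlim_real_sequentially]) (use s in auto)
  then have "eventually (\<lambda>n. real n powr (1 - s) < e) sequentially"
    using e by (auto dest: order_tendstoD)
  then obtain n where n: "real n powr (1 - s) < e" "n > 0"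
    by (metis (mono_tags, lifting) eventually_at_top_dense eventually_conj eventually_happens sequentially_bot)
  define U where "U i = (if i < n then {real i / real n..(real i + 1) / real n} else {})" for i
  have "x \<in> (\<Union>i. U i)" if "x \<in> A" for x
  proof -
    have x: "0 \<le> x" "x \<le> 1" using A that by auto
    show ?thesis
    \<comment> \<open>The point 1 belongs to the last piece; the floor used for the other points
      would give the index \<open>n\<close>, which is out of range.\<close>
    proof (cases "x = 1")
      case True
      have "x \<in> U (n - 1)" using n True by (auto simp: U_def field_simps of_nat_diff)
      then show ?thesis by blast
    next
      case False
      define i where "i = nat \<lfloor>x * real n\<rfloor>"
      have i: "real i \<le> x * real n" "x * real n < real i + 1" using x by (auto simp: i_def)
      have "x * real n < 1 * real n" using x False n by (intro mult_strict_right_mono) auto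
      then have "i < n" using i by linarith
      then have "x \<in> U i" using i n by (auto simp: U_def field_simps)
      then show ?thesis by blast
    qed
  qed
  moreover have "bounded (U i)" for i by (auto simp: U_def)
  moreover have "(\<Sum>i. ennreal (diameter (U i) powr s)) \<le> ennreal e"
  proof -
    have d: "diameter (U i) = 1 / real n" if "i < n" for i
    proof -
      have "real i / real n \<le> (real i + 1) / real n" by (rule divide_right_mono) simp_all
      then show ?thesis using that by (simp add: U_def diff_divide_distrib[symmetric])
    qed
    have "(\<Sum>i. ennreal (diameter (U i) powr s)) = (\<Sum>i<n. ennreal (diameter (U i) powr s))"
      by (rule suminf_finite) (auto simp: U_def)
    also have "\<dots> = (\<Sum>i<n. ennreal ((1 / real n) powr s))" by (intro sum.cong) (auto simp: d)
    also have "\<dots> = ennreal (real n * (1 / real n) powr s)" by (simp add: ennreal_mult ennreal_of_nat_eq_real_of_nat)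
    also have "real n * (1 / real n) powr s = real n powr (1 - s)"
      using n by (simp add: powr_diff powr_divide)
    finally show ?thesis using n by (simp add: ennreal_leI)
  qed
  ultimately show "\<exists>U. A \<subseteq> (\<Union>i. U i) \<and> (\<forall>i. bounded (U i)) \<and> (\<Sum>i. ennreal (diameter (U i) powr s)) \<le> ennreal e"
    by (intro exI[of _ U]) blast
qed (use s in simp)

lemma hausdorff_dim_eq_1:
  fixes A :: "real set"
  assumes "A \<subseteq> {0..1}" "\<not> negligible A"
  shows "hausdorff_dim A = 1"
proof (rule antisym)
  show "hausdorff_dim A \<le> 1"
    using assms(1) by (intro hausdorff_dim_le hausdorff_null_unit) auto
  show "1 \<le> hausdorff_dim A"
    using assms(2) hausdorff_null_imp_negligible[of _ A] by (intro hausdorff_dim_ge) force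
qed

text \<open>Turns an exponent above the claimed dimension into a growth factor below
  \<open>\<beta>\<close> that satisfies the hypothesis of \<open>dim_upper\<close>.\<close>

lemma dim_formula_less:
  assumes g: "\<gamma> > 1" and be: "1 \<le> \<beta>" and s: "0 < s" and less: "1 / (ereal (\<gamma> - 1) * \<beta> + 1) < ereal s"
  shows "\<exists>b>0. ereal b < \<beta> \<and> 1 < s * (1 + b * (\<gamma> - 1))"
proof (cases \<beta>)
  case (real y)
  then have y: "y \<ge> 1" using be by simp
  \<comment> \<open>The solution of \<open>s * (1 + b0 * (\<gamma> - 1)) = 1\<close>.\<close>
  define b0 where "b0 = (1 / s - 1) / (\<gamma> - 1)"
  have p: "(\<gamma> - 1) * y + 1 > 0" using y g by (simp add: add_pos_pos)
  then have "1 / ((\<gamma> - 1) * y + 1) < s" using less real by (simp add: one_ereal_def)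
  then have "1 < s * ((\<gamma> - 1) * y + 1)" using p by (simp add: field_simps)
  then have "b0 < y" using s g by (simp add: b0_def field_simps)
  then have "max 0 b0 < y" using y by simp
  then obtain b where "max 0 b0 < b" "b < y" using dense by blast
  then have b: "b > 0" "b < y" "b > b0" by auto
  then have "1 < s * (1 + b * (\<gamma> - 1))" using s g by (simp add: b0_def field_simps)
  then show ?thesis using b real by auto
next
  case PInf
  \<comment> \<open>Every real factor is below an infinite \<open>\<beta>\<close>; this one makes
    the right-hand side equal to \<open>s + 1\<close>.\<close>
  have "1 < s * (1 + 1 / (s * (\<gamma> - 1)) * (\<gamma> - 1))" using s g by (simp add: field_simps)
  then show ?thesis using s g PInf by (intro exI[of _ "1 / (s * (\<gamma> - 1))"]) simp
qed (use be in auto)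

text \<open>The counterpart for lower bounds. An infinite \<open>\<beta>\<close> is excluded,
  because the formula is then 0 and no positive \<open>s\<close> lies below it.\<close>

lemma dim_formula_greater:
  assumes g: "\<gamma> > 1" and be: "1 \<le> \<beta>" and s: "0 < s" and less: "ereal s < 1 / (ereal (\<gamma> - 1) * \<beta> + 1)"
  shows "\<exists>b. \<beta> < ereal b \<and> s * (1 + b * (\<gamma> - 1)) < 1"
proof (cases \<beta>)
  case (real y)
  then have y: "y \<ge> 1" using be by simp
  define b0 where "b0 = (1 / s - 1) / (\<gamma> - 1)"
  have p: "(\<gamma> - 1) * y + 1 > 0" using y g by (simp add: add_pos_pos)
  then have "s < 1 / ((\<gamma> - 1) * y + 1)" using less real by (simp add: one_ereal_def)
  then have "s * ((\<gamma> - 1) * y + 1) < 1" using p by (simp add: field_simps)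
  then have "y < b0" using s g by (simp add: b0_def field_simps)
  then obtain b where b: "y < b" "b < b0" using dense by blast
  then have "s * (1 + b * (\<gamma> - 1)) < 1" using s g by (simp add: b0_def field_simps)
  then show ?thesis using b real by auto
next
  case PInf
  then show ?thesis using less s g by simp
qed (use be in auto)

lemma dim_formula_nonneg:
  assumes "\<gamma> > 1" "1 \<le> \<beta>"
  shows "0 \<le> 1 / (ereal (\<gamma> - 1) * \<beta> + 1)"
proof (cases \<beta>)
  case (real y)
  then have y: "y \<ge> 1" using assms by simp
  have p: "(\<gamma> - 1) * y + 1 > 0" using y assms by (simp add: add_pos_pos)
  then show ?thesis using real by (simp add: one_ereal_def)
qed (use assms in auto)

lemma limsup_gt_frequently:
  fixes X :: "nat \<Rightarrow> real"
  assumes "ereal b < limsup (\<lambda>n. ereal (X n))"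
  shows "\<exists>\<^sub>F n in sequentially. b < X n"
proof (rule ccontr)
  assume "\<not> ?thesis"
  then have "\<forall>\<^sub>F n in sequentially. ereal (X n) \<le> ereal b"
    by (simp add: not_frequently not_less)
  then have "limsup (\<lambda>n. ereal (X n)) \<le> ereal b" by (rule Limsup_bounded)
  with assms show False by simp
qed

lemma limsup_less_eventually:
  fixes X :: "nat \<Rightarrow> real"
  assumes "limsup (\<lambda>n. ereal (X n)) < ereal b"
  shows "\<forall>\<^sub>F n in sequentially. X n < b"
  using Limsup_lessD[OF assms] by simp

section \<open>Scaling functions and upper bounds for the level sets\<close>

locale scaling =
  fixes \<psi> :: "nat \<Rightarrow> real"
  assumes psi_lim: "filterlim (\<lambda>n. \<psi> n / real n) at_top sequentially"
begin

lemma psi_ge: "\<forall>\<^sub>F n in sequentially. K * real n \<le> \<psi> n"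
proof -
  have "\<forall>\<^sub>F n in sequentially. K \<le> \<psi> n / real n" using psi_lim by (simp add: filterlim_at_top)
  then show ?thesis using eventually_gt_at_top[of 0] by eventually_elim (simp add: field_simps)
qed

lemma psi_ge_const: "\<forall>\<^sub>F n in sequentially. K \<le> \<psi> n"
  using psi_ge[of "\<bar>K\<bar>"] eventually_gt_at_top[of 0]
proof eventually_elim
  case (elim n)
  have "\<bar>K\<bar> * 1 \<le> \<bar>K\<bar> * real n" using elim by (intro mult_left_mono) auto
  then show ?case using elim by simp
qed

lemma psi_pos: "\<forall>\<^sub>F n in sequentially. 0 < \<psi> n"
  using psi_ge_const[of 1] by eventually_elim simp

lemma growth_B_ge_1: "1 \<le> growth_B \<psi>"
  unfolding growth_B_def
proof (rule le_Limsup)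
  show "\<forall>\<^sub>F n in sequentially. 1 \<le> ereal (root n (\<psi> n))"
    using psi_ge_const[of 1] eventually_gt_at_top[of 0] by eventually_elim (simp add: one_ereal_def)
qed simp

text \<open>A limsup below 1 would make \<open>\<psi>\<close> eventually non-increasing, whereas it
  tends to infinity.\<close>

lemma growth_beta_ge_1: "1 \<le> growth_beta \<psi>"
proof (rule ccontr)
  assume "\<not> ?thesis"
  then have "limsup (\<lambda>n. ereal (\<psi> (n + 1) / \<psi> n)) < ereal 1" by (simp add: growth_beta_def one_ereal_def)
  from limsup_less_eventually[OF this] psi_pos have "\<forall>\<^sub>F n in sequentially. \<psi> (Suc n) \<le> \<psi> n"
    by eventually_elim (simp add: field_simps)
  then obtain N where N: "\<And>n. n \<ge> N \<Longrightarrow> \<psi> (Suc n) \<le> \<psi> n" by (auto simp: eventually_sequentially)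
  have "\<psi> n \<le> \<psi> N" if "n \<ge> N" for n
    using that by (induction n rule: dec_induct) (auto intro: order_trans[OF N])
  moreover obtain n where "n \<ge> N" "\<psi> N + 1 \<le> \<psi> n"
    using psi_ge_const[of "\<psi> N + 1"] unfolding eventually_sequentially by (meson nat_le_linear)
  ultimately show False by force
qed

end

locale renyi_scaling = renyi_branches + scaling
begin

lemma Lam_ge_linear:
  assumes "a > 0" "\<forall>\<^sub>F n in sequentially. a \<le> \<gamma> * Lam x n / \<psi> n"
  shows "\<forall>\<^sub>F n in sequentially. K * real n \<le> Lam x n"
  using assms(2) psi_pos psi_ge[of "K * \<gamma> / a"]
proof eventually_elim
  case (elim n)
  have "K * \<gamma> * real n \<le> a * \<psi> n" using elim(3) assms(1) by (simp add: field_simps)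
  also have "\<dots> \<le> \<gamma> * Lam x n" using elim by (simp add: field_simps)
  finally show ?case using gamma by (simp add: mult.commute mult.left_commute)
qed

text \<open>On the level set \<open>\<gamma> * Lam x n\<close> is asymptotic to
  \<open>\<alpha> * \<psi> n\<close>, so a jump of \<open>\<psi>\<close> by a factor
  \<open>b'\<close> forces a jump of \<open>Lam\<close> by any smaller factor \<open>b\<close>. The
  room between \<open>b\<close> and \<open>b'\<close> absorbs the convergence error.\<close>

lemma dim_upper_real:
  assumes al: "\<alpha> > 0"
  shows "hausdorff_dim (level_set I T \<psi> (ereal \<alpha>)) \<le> 1 / (ereal (\<gamma> - 1) * growth_beta \<psi> + 1)"
proof (rule hausdorff_dim_le)
  fix s assume s: "0 < s" "1 / (ereal (\<gamma> - 1) * growth_beta \<psi> + 1) < ereal s"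
  from dim_formula_less[OF gamma growth_beta_ge_1 s] obtain b where
    b: "b > 0" "ereal b < growth_beta \<psi>" "1 < s * (1 + b * (\<gamma> - 1))" by blast
  obtain b' where b': "b < b'" "ereal b' < growth_beta \<psi>"
    using ereal_dense2[OF b(2)] by auto
  have f: "\<exists>\<^sub>F n in sequentially. b' < \<psi> (n + 1) / \<psi> n"
    using b'(2) unfolding growth_beta_def by (rule limsup_gt_frequently)
  show "hausdorff_outer_measure s (level_set I T \<psi> (ereal \<alpha>)) = 0"
  proof (rule hausdorff_null_subset[OF dim_upper[OF b(1) s(1) b(3)] _ s(1)], intro subsetI CollectI conjI allI)
    fix x assume "x \<in> level_set I T \<psi> (ereal \<alpha>)"
    then have x: "x \<in> good" and lim: "(\<lambda>n. \<gamma> * Lam x n / \<psi> n) \<longlonglongrightarrow> \<alpha>"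
      unfolding level_set_real[OF psi_lim] by auto
    show "x \<in> good" by (rule x)
    let ?c = "\<lambda>n. \<gamma> * Lam x n / \<psi> n"
    have "\<forall>\<^sub>F n in sequentially. \<alpha> / 2 < ?c n" by (rule order_tendstoD(1)[OF lim]) (use al in simp)
    then have "\<forall>\<^sub>F n in sequentially. \<alpha> / 2 \<le> ?c n" by eventually_elim simp
    then show "\<forall>\<^sub>F n in sequentially. K * real n \<le> Lam x n" for K
      by (intro Lam_ge_linear[of "\<alpha> / 2"]) (use al in auto)
    have lim': "(\<lambda>n. ?c (Suc n) * b' - ?c n * b) \<longlonglongrightarrow> \<alpha> * b' - \<alpha> * b"
      by (intro tendsto_intros lim LIMSEQ_Suc)
    have "\<forall>\<^sub>F n in sequentially. 0 < ?c (Suc n) * b' - ?c n * b"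
      by (rule order_tendstoD(1)[OF lim']) (use al b' in simp)
    moreover have "\<forall>\<^sub>F n in sequentially. 0 < \<psi> (Suc n)" by (rule eventually_sequentially_Suc[THEN iffD2, OF psi_pos])
    ultimately have ev: "\<forall>\<^sub>F n in sequentially. ?c n * b < ?c (Suc n) * b' \<and> 0 < \<psi> n \<and> 0 < \<psi> (Suc n)"
      using psi_pos by eventually_elim simp
    show "\<exists>\<^sub>F n in sequentially. b * Lam x n \<le> Lam x (Suc n)"
    proof (rule frequently_elim1[OF frequently_eventually_frequently[OF f ev]])
      fix n assume n: "b' < \<psi> (n + 1) / \<psi> n \<and> ?c n * b < ?c (Suc n) * b' \<and> 0 < \<psi> n \<and> 0 < \<psi> (Suc n)"
      have "\<gamma> * (b * Lam x n) = (?c n * b) * \<psi> n" using n by simp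
      also have "\<dots> \<le> (?c (Suc n) * b') * \<psi> n" using n by (intro mult_right_mono) auto
      also have "\<dots> = ?c (Suc n) * (b' * \<psi> n)" by simp
      also have "\<dots> \<le> ?c (Suc n) * \<psi> (Suc n)"
        using n Lam_nonneg[OF x] gamma by (intro mult_left_mono) (auto simp: field_simps)
      also have "\<dots> = \<gamma> * Lam x (Suc n)" using n by simp
      finally show "b * Lam x n \<le> Lam x (Suc n)" using gamma by simp
    qed
  qed
qed (intro dim_formula_nonneg gamma growth_beta_ge_1)

text \<open>If \<open>Lam x\<close> eventually grew by at most the factor \<open>b\<close> per step,
  it would be at most \<open>D * b ^ n\<close>. Since eventually
  \<open>\<psi> n \<le> \<gamma> * Lam x n\<close>, this contradicts
  \<open>b' ^ n < \<psi> n\<close> for infinitely many \<open>n\<close>, where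
  \<open>b' > b\<close>.\<close>

lemma dim_upper_infinite:
  "hausdorff_dim (level_set I T \<psi> \<infinity>) \<le> 1 / (ereal (\<gamma> - 1) * growth_B \<psi> + 1)"
proof (rule hausdorff_dim_le)
  fix s assume s: "0 < s" "1 / (ereal (\<gamma> - 1) * growth_B \<psi> + 1) < ereal s"
  from dim_formula_less[OF gamma growth_B_ge_1 s] obtain b where
    b: "b > 0" "ereal b < growth_B \<psi>" "1 < s * (1 + b * (\<gamma> - 1))" by blast
  obtain b' where b': "b < b'" "ereal b' < growth_B \<psi>"
    using ereal_dense2[OF b(2)] by auto
  have f: "\<exists>\<^sub>F n in sequentially. b' < root n (\<psi> n)"
    using b'(2) unfolding growth_B_def by (rule limsup_gt_frequently)
  show "hausdorff_outer_measure s (level_set I T \<psi> \<infinity>) = 0"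
  proof (rule hausdorff_null_subset[OF dim_upper[OF b(1) s(1) b(3)] _ s(1)], intro subsetI CollectI conjI allI)
    fix x assume "x \<in> level_set I T \<psi> \<infinity>"
    then have x: "x \<in> good" and lim: "filterlim (\<lambda>n. \<gamma> * Lam x n / \<psi> n) at_top sequentially"
      unfolding level_set_infinite[OF psi_lim] by auto
    show "x \<in> good" by (rule x)
    have ge1: "\<forall>\<^sub>F n in sequentially. 1 \<le> \<gamma> * Lam x n / \<psi> n" using lim by (simp add: filterlim_at_top)
    then show "\<forall>\<^sub>F n in sequentially. K * real n \<le> Lam x n" for K
      by (intro Lam_ge_linear[of 1]) auto
    show "\<exists>\<^sub>F n in sequentially. b * Lam x n \<le> Lam x (Suc n)"
    proof (rule ccontr)
      assume "\<not> ?thesis"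
      then have "\<forall>\<^sub>F n in sequentially. Lam x (Suc n) \<le> b * Lam x n"
        unfolding not_frequently by (rule eventually_mono) simp
      then obtain N where N: "\<And>n. n \<ge> N \<Longrightarrow> Lam x (Suc n) \<le> b * Lam x n" by (auto simp: eventually_sequentially)
      define D where "D = Lam x N / b ^ N"
      have D: "Lam x n \<le> D * b ^ n" if "n \<ge> N" for n
        using that
      proof (induction n rule: dec_induct)
        case base
        then show ?case using b by (simp add: D_def)
      next
        case (step n)
        have "Lam x (Suc n) \<le> b * Lam x n" by (rule N) (use step in simp)
        also have "\<dots> \<le> b * (D * b ^ n)" using step b by (intro mult_left_mono) auto
        finally show ?case by (simp add: mult_ac)
      qed
      have "\<forall>\<^sub>F n in sequentially. \<gamma> * D < (b' / b) ^ n"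
      proof -
        obtain M where M: "\<gamma> * D < (b' / b) ^ M" using real_arch_pow[of "b' / b"] b b' by auto
        have "(b' / b) ^ M \<le> (b' / b) ^ n" if "n \<ge> M" for n
          using that b b' by (intro power_increasing) auto
        then show ?thesis using M by (auto simp: eventually_sequentially intro: less_le_trans)
      qed
      with ge1 psi_pos eventually_gt_at_top[of 0] eventually_ge_at_top[of N]
      have ev: "\<forall>\<^sub>F n in sequentially. root n (\<psi> n) \<le> b'"
      proof eventually_elim
        case (elim n)
        show ?case
        proof (rule ccontr)
          assume "\<not> ?thesis"
          then have "b' ^ n < root n (\<psi> n) ^ n" using b b' elim by (intro power_strict_mono) auto
          also have "\<dots> = \<psi> n" using elim by (intro real_root_pow_pos) auto
          also have "\<dots> \<le> \<gamma> * Lam x n" using elim by (simp add: field_simps)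
          also have "\<dots> \<le> \<gamma> * (D * b ^ n)" using D[of n] elim gamma by (intro mult_left_mono) auto
          finally show False using elim(1) elim b by (simp add: power_divide field_simps)
        qed
      qed
      from frequently_eventually_frequently[OF f ev] have "\<exists>\<^sub>F n in sequentially. False"
        by (rule frequently_elim1) auto
      then show False by simp
    qed
  qed
qed (intro dim_formula_nonneg gamma growth_B_ge_1)

lemma nonempty_imp_equivalent:
  assumes al: "\<alpha> > 0" and ne: "level_set I T \<psi> (ereal \<alpha>) \<noteq> {}"
  shows "equivalent_to_increasing \<psi>"
proof -
  obtain x where x: "x \<in> good" and lim: "(\<lambda>n. \<gamma> * Lam x n / \<psi> n) \<longlonglongrightarrow> \<alpha>"
    using ne unfolding level_set_real[OF psi_lim] by auto
  \<comment> \<open>The increasing function is read off from a single point of the level set. The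
    summand \<open>real n\<close> makes it positive even while all digits are 1, and is negligible
    against \<open>\<psi> n\<close>.\<close>
  define \<phi> where "\<phi> n = (\<gamma> * Lam x n + real n) / \<alpha>" for n
  have "(\<lambda>n. (\<gamma> * Lam x n / \<psi> n + 1 * real n / \<psi> n) / \<alpha>) \<longlonglongrightarrow> (\<alpha> + 0) / \<alpha>"
    using al by (intro tendsto_intros lim linear_over_scale_tendsto_0 psi_lim) auto
  then have "(\<lambda>n. (\<gamma> * Lam x n / \<psi> n + 1 * real n / \<psi> n) / \<alpha>) \<longlonglongrightarrow> 1" using al by simp
  moreover have "(\<gamma> * Lam x n / \<psi> n + 1 * real n / \<psi> n) / \<alpha> = \<phi> n / \<psi> n" for n
    by (simp add: \<phi>_def add_divide_distrib mult.commute)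
  ultimately have "(\<lambda>n. \<phi> n / \<psi> n) \<longlonglongrightarrow> 1" by simp
  then have "(\<lambda>n. inverse (\<phi> n / \<psi> n)) \<longlonglongrightarrow> inverse 1" by (intro tendsto_inverse) auto
  then have "(\<lambda>n. \<psi> n / \<phi> n) \<longlonglongrightarrow> 1" by simp
  moreover have "\<phi> n > 0" if "n \<ge> 1" for n
    using that al gamma Lam_nonneg[OF x, of n] unfolding \<phi>_def by (intro divide_pos_pos add_nonneg_pos mult_nonneg_nonneg) auto
  moreover have "\<phi> n \<le> \<phi> (n + 1)" for n
    using al gamma Lam_mono[OF x, of n] unfolding \<phi>_def by (intro divide_right_mono add_mono mult_left_mono) auto
  ultimately show ?thesis unfolding equivalent_to_increasing_def by blast
qed

end

section \<open>The level set at zero\<close>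

context renyi_branches
begin

text \<open>\<open>T\<close> is injective on each open interval, and the endpoints add only
  countably many points.\<close>

lemma countable_preimage:
  assumes "countable A"
  shows "countable {x \<in> mr_domain I. T x \<in> A}"
proof -
  have "countable {x \<in> I n. T x \<in> A}" if n: "n \<ge> 1" for n
  proof (rule countable_image_inj_on)
    have eq: "S n ` {x \<in> I n. T x \<in> A} = T ` {x \<in> I n. T x \<in> A}"
      by (intro image_cong) (auto simp: T_eq[OF n])
    then show "countable (S n ` {x \<in> I n. T x \<in> A})"
      by (auto intro: countable_subset[OF _ assms])
    show "inj_on (S n) {x \<in> I n. T x \<in> A}"
      using S_inj[OF n] by (rule inj_on_subset) (auto simp: I_eq[OF n])
  qed
  moreover have "countable (frontier (I n))" if "n \<ge> 1" for n using frontier_I[OF that] by simp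
  ultimately have "countable (\<Union>n\<in>{1..}. {x \<in> I n. T x \<in> A} \<union> frontier (I n))"
    by (intro countable_UN) auto
  moreover have "{x \<in> mr_domain I. T x \<in> A} \<subseteq> (\<Union>n\<in>{1..}. {x \<in> I n. T x \<in> A} \<union> frontier (I n))"
  proof
    fix x assume x: "x \<in> {x \<in> mr_domain I. T x \<in> A}"
    then obtain n where n: "n \<ge> 1" "x \<in> closure (I n)" unfolding mr_domain_def by auto
    then have "x \<in> I n \<or> x \<in> frontier (I n)" using interior_open[OF open_I[OF n(1)]] by (auto simp: frontier_def)
    then show "x \<in> (\<Union>n\<in>{1..}. {x \<in> I n. T x \<in> A} \<union> frontier (I n))" using x n by auto
  qed
  ultimately show ?thesis by (rule countable_subset[rotated])
qed

lemma countable_exceptional_set: "countable (exceptional_set I T)"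
proof -
  let ?Q = "{0, 1} \<union> (\<Union>n\<in>{1..}. frontier (I n))"
  have Q: "countable ?Q" using frontier_I by (intro countable_Un countable_UN) auto
  have "countable {x. (\<forall>j<k. (T ^^ j) x \<in> mr_domain I) \<and> (T ^^ k) x \<in> ?Q}" for k
  proof (induction k)
    case 0
    have "{x. (\<forall>j<0. (T ^^ j) x \<in> mr_domain I) \<and> (T ^^ 0) x \<in> ?Q} = ?Q" by auto
    then show ?case using Q by simp
  next
    case (Suc k)
    have "{x. (\<forall>j<Suc k. (T ^^ j) x \<in> mr_domain I) \<and> (T ^^ Suc k) x \<in> ?Q} \<subseteq>
      {x \<in> mr_domain I. T x \<in> {x. (\<forall>j<k. (T ^^ j) x \<in> mr_domain I) \<and> (T ^^ k) x \<in> ?Q}}"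
    proof
      fix x assume x: "x \<in> {x. (\<forall>j<Suc k. (T ^^ j) x \<in> mr_domain I) \<and> (T ^^ Suc k) x \<in> ?Q}"
      then have "\<forall>j<Suc k. (T ^^ j) x \<in> mr_domain I" by blast
      then have "(T ^^ 0) x \<in> mr_domain I" "\<forall>j<k. (T ^^ Suc j) x \<in> mr_domain I" by blast+
      then show "x \<in> {x \<in> mr_domain I. T x \<in> {x. (\<forall>j<k. (T ^^ j) x \<in> mr_domain I) \<and> (T ^^ k) x \<in> ?Q}}"
        using x by (simp add: funpow_Suc_right del: funpow.simps)
    qed
    with countable_preimage[OF Suc] show ?case by (rule countable_subset[rotated])
  qed
  then show ?thesis unfolding exceptional_set_def by (intro countable_UN) auto
qed

end

context renyi_scaling
begin

text \<open>Applying \<open>large_negligible\<close> with constants tending to 0 shows that the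
  level set fills the union of the open intervals up to a null set; its measure and its dimension
  follow.\<close>

lemma level_set_zero:
  assumes def: "iterates_defined_on_repeller I T"
  shows "level_set I T \<psi> 0 \<in> sets lebesgue"
    and "emeasure lebesgue (level_set I T \<psi> 0) = (\<Sum>n. ennreal (diameter (I (Suc n))))"
    and "hausdorff_dim (level_set I T \<psi> 0) = 1"
proof -
  let ?J = "level_set I T \<psi> 0"
  define V where "V = (\<Union>n. I (Suc n))"
  \<comment> \<open>Outside this null set, a point of \<open>V\<close> is good and
    \<open>Lam x n / \<psi> n\<close> is eventually below each \<open>1 / (j + 1)\<close>.\<close>
  define N where "N = exceptional_set I T \<union> (\<Union>j. {x \<in> good. \<exists>\<^sub>F n in sequentially. inverse (real (Suc j)) * \<psi> n \<le> Lam x n})"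
  have J: "?J = {x \<in> good. (\<lambda>n. \<gamma> * Lam x n / \<psi> n) \<longlonglongrightarrow> 0}"
    using level_set_real[OF psi_lim, of 0] by (simp add: zero_ereal_def)
  have "negligible (exceptional_set I T)" 
    using countable_imp_null_set_lborel[OF countable_exceptional_set]
    by (simp add: negligible_iff_null_sets null_sets_completionI)
  then have neg: "negligible N" unfolding N_def
    by (intro negligible_Un negligible_countable_Union) (auto intro!: large_negligible psi_lim)
  have VJ: "V - ?J \<subseteq> N"
  proof
    fix x assume x: "x \<in> V - ?J"
    then obtain n where "x \<in> I (Suc n)" unfolding V_def by auto
    then have dom: "x \<in> mr_domain I" unfolding mr_domain_def using closure_subset[of "I (Suc n)"] by auto
    show "x \<in> N"
    proof (rule ccontr)
      assume xN: "x \<notin> N"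
      then have "x \<in> repeller I T" using dom by (auto simp: repeller_def N_def)
      then have xg: "x \<in> good" using def unfolding good_eq iterates_defined_on_repeller_def by auto
      have "(\<lambda>n. \<gamma> * Lam x n / \<psi> n) \<longlonglongrightarrow> 0"
      proof (rule tendstoI)
        fix e :: real assume e: "e > 0"
        obtain j where j: "inverse (real (Suc j)) < e / \<gamma>" using reals_Archimedean[of "e / \<gamma>"] e gamma by auto
        have "\<forall>\<^sub>F n in sequentially. Lam x n < inverse (real (Suc j)) * \<psi> n"
          using xN xg unfolding N_def by (auto simp: not_frequently not_le)
        with psi_pos show "\<forall>\<^sub>F n in sequentially. dist (\<gamma> * Lam x n / \<psi> n) 0 < e"
        proof eventually_elim
          case (elim n)
          have "Lam x n / \<psi> n < inverse (real (Suc j))" using elim by (subst pos_divide_less_eq) auto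
          also note j
          finally have "\<gamma> * (Lam x n / \<psi> n) < e" using gamma by (simp add: field_simps)
          then show ?case using elim Lam_nonneg[OF xg, of n] gamma by (simp add: dist_real_def)
        qed
      qed
      with x xg J show False by auto
    qed
  qed
  have JV: "?J \<subseteq> V"
  proof
    fix x assume "x \<in> ?J"
    then have xg: "x \<in> good" using J by auto
    from digit[OF xg, of 0] have "x \<in> I (Suc (digit x 0 - 1))" by simp
    then show "x \<in> V" unfolding V_def by blast
  qed
  have Im: "I (Suc n) \<in> sets lebesgue" for n using open_I[of "Suc n"] by simp
  then have Vm: "V \<in> sets lebesgue" unfolding V_def by auto
  have "negligible (V - ?J)" using neg VJ by (rule negligible_subset)
  then have null: "V - ?J \<in> null_sets lebesgue" by (simp add: negligible_iff_null_sets)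
  \<comment> \<open>Measurability comes from completeness of \<open>lebesgue\<close>: the level set
    is an open set minus a null set.\<close>
  have Jeq: "?J = V - (V - ?J)" using JV by auto
  show Jm: "?J \<in> sets lebesgue" by (subst Jeq) (use Vm null in auto)
  have "emeasure lebesgue ?J = emeasure lebesgue V"
    by (subst Jeq, rule emeasure_Diff_null_set[OF null Vm])
  also have "\<dots> = (\<Sum>n. emeasure lebesgue (I (Suc n)))" unfolding V_def
    using Im disj by (intro suminf_emeasure[symmetric]) (auto simp: disjoint_family_on_def)
  also have "\<dots> = (\<Sum>n. ennreal (diameter (I (Suc n))))"
  proof (intro suminf_cong)
    fix n
    show "emeasure lebesgue (I (Suc n)) = ennreal (diameter (I (Suc n)))"
      using I_eq[of "Suc n"] lr[of "Suc n"] by simp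
  qed
  finally show em: "emeasure lebesgue ?J = (\<Sum>n. ennreal (diameter (I (Suc n))))" .
  show "hausdorff_dim ?J = 1"
  proof (rule hausdorff_dim_eq_1)
    show "?J \<subseteq> {0..1}" using J good_in[of _ 0] by force
    have "0 < ennreal (diameter (I (Suc 0)))" using I_eq[of "Suc 0"] lr[of "Suc 0"] by simp
    also have "\<dots> \<le> emeasure lebesgue ?J"
    proof -
      have "(\<Sum>n\<in>{0}. ennreal (diameter (I (Suc n)))) \<le> (\<Sum>n. ennreal (diameter (I (Suc n))))"
        by (rule sum_le_suminf) auto
      then show ?thesis using em by simp
    qed
    finally have "emeasure lebesgue ?J \<noteq> 0" by simp
    then show "\<not> negligible ?J" by (auto simp: negligible_iff_null_sets)
  qed
qed

end

section \<open>A Cantor set with prescribed digit growth\<close>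

text \<open>A weighted geometric mean of two upper bounds is an upper bound. It will interpolate
  between counting bounds at two consecutive scales.\<close>

lemma weighted_min_le:
  fixes a b x s :: real
  assumes "x \<le> a" "x \<le> b" "0 < a" "0 < b" "0 < s" "s < 1"
  shows "x \<le> a powr (1 - s) * b powr s"
proof (cases "x > 0")
  case True
  have "x = x powr (1 - s) * x powr s" using True by (simp add: powr_add[symmetric])
  also have "\<dots> \<le> a powr (1 - s) * b powr s"
    using True assms by (intro mult_mono powr_mono2) auto
  finally show ?thesis .
next
  case False
  have "0 \<le> a powr (1 - s) * b powr s" by simp
  then show ?thesis using False by linarith
qed

context renyi_branches
begin

text \<open>Each application of \<open>T\<close> strips the first letter, because
  \<open>T (g a z) = z\<close> for \<open>z\<close> in the open unit interval.\<close>

lemma orbit_of_word: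
  assumes "0 \<notin> set w" "y \<in> {0<..<1}" "j < length w"
  shows "(T ^^ j) (foldr g w y) \<in> I (w ! j)"
  using assms
proof (induction w arbitrary: j)
  case (Cons a w)
  have a: "a \<ge> 1" using Cons by (auto simp: Suc_le_eq)
  let ?z = "foldr g w y"
  have z: "?z \<in> {0<..<1}" using Cons by (intro words_open) auto
  have ga: "g a ?z \<in> I a" by (rule g_open[OF a z])
  have T: "T (g a ?z) = ?z" using T_eq[OF a ga] S_g[OF a, of ?z] z by auto
  show ?case
  proof (cases j)
    case 0
    then show ?thesis using ga by simp
  next
    case (Suc i)
    then show ?thesis using Cons.IH[of i] Cons.prems by (simp add: funpow_Suc_right T del: funpow.simps)
  qed
qed simp

lemma words_continuous: assumes "0 \<notin> set w" shows "continuous_on {0..1} (foldr g w)"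
proof -
  have "(C ^ length w * word_prod w powr - \<gamma>)-lipschitz_on {0..1} (foldr g w)"
    using words_dist(1)[OF assms] C by (intro lipschitz_onI) (auto simp: dist_real_def)
  then show ?thesis by (rule lipschitz_on_continuous_on)
qed

lemma words_inj: assumes "0 \<notin> set w" shows "inj_on (foldr g w) {0..1}"
proof (rule inj_onI)
  fix x y assume xy: "x \<in> {0..1::real}" "y \<in> {0..1}" "foldr g w x = foldr g w y"
  define k where "k = word_prod w powr - \<gamma> / C ^ length w"
  have "k > 0" using word_prod_pos[OF assms] C by (simp add: k_def)
  moreover have "k * \<bar>x - y\<bar> \<le> 0" using words_dist(2)[OF assms xy(1,2)] xy(3) by (simp add: k_def)
  ultimately show "x = y" by (simp add: mult_le_0_iff)
qed

lemma cylinder_interval: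
  assumes "0 \<notin> set w"
  obtains p q where "foldr g w ` {0..1} = {p..q}" "foldr g w ` {0<..<1} = {p<..<q}"
    "word_prod w powr - \<gamma> / C ^ length w \<le> q - p"
proof -
  obtain p q where pq: "foldr g w ` {0..1} = {p..q}"
    using continuous_image_closed_interval[OF _ words_continuous[OF assms]] by auto
  have "foldr g w 0 \<in> {p..q}" "foldr g w 1 \<in> {p..q}" using pq by auto
  then have "word_prod w powr - \<gamma> / C ^ length w \<le> q - p"
    using words_dist(2)[OF assms, of 0 1] by auto
  moreover have "foldr g w ` {0<..<1} = {p<..<q}"
    by (rule continuous_inj_open_image[OF _ words_continuous[OF assms] words_inj[OF assms] pq]) simp
  ultimately show ?thesis using pq that by blast
qed

end

text \<open>With \<open>N n \<ge> 2\<close> the digit 1 never occurs, so \<open>inner_closed\<close>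
  applies to every digit used.\<close>

locale cantor_construction = renyi_branches +
  fixes N :: "nat \<Rightarrow> nat"
  assumes N: "N n \<ge> 2"
begin

definition M :: "nat \<Rightarrow> real" where "M n = (\<Prod>i<n. real (N i))"

text \<open>A lower bound for the length of every cylinder of level \<open>n\<close>: digits below
  \<open>2 * N i\<close> have a product of at most \<open>2 ^ n * M n\<close>.\<close>

definition \<delta> :: "nat \<Rightarrow> real" where "\<delta> n = (2 ^ n * M n) powr - \<gamma> / C ^ n"

definition W :: "nat \<Rightarrow> nat list set" where
  "W n = {w. length w = n \<and> (\<forall>i<n. w ! i \<in> {N i..<2 * N i})}"

text \<open>Closed cylinders make each stage compact. Their endpoints do no harm in the limit, by
  \<open>limit_set_orbit\<close>.\<close>

definition E :: "nat \<Rightarrow> real set" where "E n = (\<Union>w\<in>W n. foldr g w ` {0..1})"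

definition limit_set :: "real set" where "limit_set = (\<Inter>n. E n)"

lemma M_Suc: "M (Suc n) = M n * real (N n)" by (simp add: M_def)

lemma M_ge_1: "M n \<ge> 1"
  unfolding M_def using N by (intro prod_ge_1) (metis Suc_1 Suc_leD of_nat_1 of_nat_le_iff One_nat_def)

lemma M_pos: "M n > 0" using M_ge_1[of n] by simp

lemma \<delta>_pos: "\<delta> n > 0" using M_pos[of n] C by (simp add: \<delta>_def)

lemma \<delta>_0: "\<delta> 0 = 1" by (simp add: \<delta>_def M_def)

lemma \<delta>_le: "\<delta> n \<le> (1 / C) ^ n"
proof -
  have "1 * 1 \<le> 2 ^ n * M n" using M_ge_1 by (intro mult_mono) auto
  then have "(2 ^ n * M n) powr - \<gamma> \<le> 1 powr - \<gamma>" using gamma by (intro powr_mono2') auto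
  then show ?thesis using C by (simp add: \<delta>_def power_divide divide_right_mono)
qed

lemma W_0: "W 0 = {[]}" by (auto simp: W_def)

lemma W_Suc: "W (Suc n) = (\<lambda>(w, a). w @ [a]) ` (W n \<times> {N n..<2 * N n})"
proof (intro equalityI subsetI)
  fix w assume w: "w \<in> W (Suc n)"
  then have "w \<noteq> []" by (auto simp: W_def)
  then have eq: "w = butlast w @ [last w]" by simp
  have len: "length w = Suc n" using w by (simp add: W_def)
  have "butlast w \<in> W n" using w by (auto simp: W_def nth_butlast)
  moreover have "last w \<in> {N n..<2 * N n}" using w len \<open>w \<noteq> []\<close> by (auto simp: W_def last_conv_nth)
  ultimately show "w \<in> (\<lambda>(w, a). w @ [a]) ` (W n \<times> {N n..<2 * N n})" using eq by force
next
  fix w assume "w \<in> (\<lambda>(w, a). w @ [a]) ` (W n \<times> {N n..<2 * N n})"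
  then show "w \<in> W (Suc n)" by (auto simp: W_def nth_append less_Suc_eq)
qed

lemma finite_W: "finite (W n)"
  by (induction n) (auto simp: W_0 W_Suc)

lemma card_W: "real (card (W n)) = M n"
proof (induction n)
  case (Suc n)
  have "card (W (Suc n)) = card (W n \<times> {N n..<2 * N n})"
    unfolding W_Suc by (intro card_image) (auto simp: inj_on_def)
  then show ?case using Suc by (simp add: M_Suc card_cartesian_product)
qed (simp add: W_0 M_def)

lemma W_pos: "w \<in> W n \<Longrightarrow> 0 \<notin> set w"
  using N by (auto simp: W_def in_set_conv_nth)

lemma W_word_prod: "w \<in> W n \<Longrightarrow> word_prod w \<le> 2 ^ n * M n"
proof (induction n arbitrary: w)
  case (Suc n)
  then obtain v a where va: "v \<in> W n" "a < 2 * N n" "w = v @ [a]" by (auto simp: W_Suc)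
  have "word_prod w = word_prod v * real a" using va by simp
  also have "\<dots> \<le> (2 ^ n * M n) * (2 * real (N n))"
    using va Suc.IH[OF va(1)] M_pos[of n] by (intro mult_mono) auto
  finally show ?case by (simp add: M_Suc mult_ac)
qed (simp add: W_0 M_def)

lemma W_cylinder_interval:
  assumes "w \<in> W n"
  obtains p q where "foldr g w ` {0..1} = {p..q}" "foldr g w ` {0<..<1} = {p<..<q}" "\<delta> n \<le> q - p"
proof -
  have len: "length w = n" using assms by (simp add: W_def)
  obtain p q where pq: "foldr g w ` {0..1} = {p..q}" "foldr g w ` {0<..<1} = {p<..<q}"
    "word_prod w powr - \<gamma> / C ^ length w \<le> q - p"
    by (rule cylinder_interval[OF W_pos[OF assms]])
  have "(2 ^ n * M n) powr - \<gamma> \<le> word_prod w powr - \<gamma>"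
    using W_word_prod[OF assms] word_prod_pos[OF W_pos[OF assms]] gamma by (intro powr_mono2') auto
  then have "\<delta> n \<le> word_prod w powr - \<gamma> / C ^ length w"
    using C len by (simp add: \<delta>_def divide_right_mono)
  with pq that show ?thesis by force
qed

lemma compact_E: "compact (E n)"
  unfolding E_def using finite_W words_continuous[OF W_pos]
  by (intro compact_UN compact_continuous_image) auto

lemma E_Suc: "E (Suc n) \<subseteq> E n"
proof
  fix x assume "x \<in> E (Suc n)"
  then obtain v a y where *: "v \<in> W n" "a \<in> {N n..<2 * N n}" "y \<in> {0..1}" "x = foldr g (v @ [a]) y"
    unfolding E_def W_Suc by auto
  have a: "a \<ge> 1" using *(2) N[of n] by auto
  have "g a y \<in> {0..1}" using g_in[OF a *(3)] closed_subset[OF a] by blast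
  moreover have "x = foldr g v (g a y)" using * by simp
  ultimately show "x \<in> E n" using *(1) unfolding E_def by blast
qed

lemma E_antimono: "m \<le> n \<Longrightarrow> E n \<subseteq> E m"
  by (induction n rule: dec_induct) (use E_Suc in blast)+

lemma W_nonempty: "W n \<noteq> {}"
  using card_W[of n] M_pos[of n] by auto

text \<open>Compactness of the nested stages; it lets an open cover of the limit set be tested on
  the words of a finite stage.\<close>

lemma E_subset_open:
  assumes "open V" "limit_set \<subseteq> V"
  shows "\<exists>n. E n \<subseteq> V"
proof (rule ccontr)
  assume "\<not> ?thesis"
  then have 1: "E n - V \<noteq> {}" for n by blast
  have 2: "compact (E n - V)" for n using compact_E assms(1) by (rule compact_diff)
  have 3: "m \<le> n \<Longrightarrow> E n - V \<subseteq> E m - V" for m n using E_antimono by blast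
  have "(\<Inter>n. E n - V) \<noteq> {}" by (rule compact_nest[OF 2 1 3])
  then show False using assms(2) unfolding limit_set_def by blast
qed

lemma limit_set_nonempty: "limit_set \<noteq> {}"
proof
  assume "limit_set = {}"
  with E_subset_open[of "{}"] obtain n where "E n = {}" by auto
  then show False using W_nonempty[of n] unfolding E_def by auto
qed

lemma limit_set_orbit:
  assumes "x \<in> limit_set"
  shows "\<exists>a\<in>{N n..<2 * N n}. (T ^^ n) x \<in> I a"
proof -
  \<comment> \<open>One level more than digit \<open>n\<close> requires: the extra digit
    \<open>a \<ge> 2\<close> moves \<open>g a y\<close> into the open unit interval, where
    \<open>orbit_of_word\<close> applies.\<close>
  have "x \<in> E (Suc (Suc n))" using assms by (auto simp: limit_set_def)
  then obtain v a y where *: "v \<in> W (Suc n)" "a \<in> {N (Suc n)..<2 * N (Suc n)}" "y \<in> {0..1}" "x = foldr g (v @ [a]) y"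
    unfolding E_def W_Suc[of "Suc n"] by auto
  have a: "a \<ge> 1" "a \<ge> 2" using *(2) N[of "Suc n"] by auto
  have "g a y \<in> {0<..<1}" using g_in[OF a(1) *(3)] inner_closed[OF a(2)] by blast
  then have "(T ^^ n) (foldr g v (g a y)) \<in> I (v ! n)"
    using * W_pos[OF *(1)] by (intro orbit_of_word) (auto simp: W_def)
  then show ?thesis using * by (auto simp: W_def)
qed

lemma limit_set_good: assumes "x \<in> limit_set" shows "x \<in> good"
proof -
  have "\<exists>a\<ge>1. (T ^^ n) x \<in> I a" for n
  proof -
    obtain a where "a \<in> {N n..<2 * N n}" "(T ^^ n) x \<in> I a" using limit_set_orbit[OF assms] by blast
    then show ?thesis using N[of n] by (intro exI[of _ a]) auto
  qed
  then show ?thesis by (simp add: good_def)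
qed

lemma limit_set_digit: assumes "x \<in> limit_set" shows "digit x n \<in> {N n..<2 * N n}"
proof -
  obtain a where a: "a \<in> {N n..<2 * N n}" "(T ^^ n) x \<in> I a" using limit_set_orbit[OF assms] by blast
  then have "digit x n = a" using N[of n] by (intro digit_unique limit_set_good assms) auto
  then show ?thesis using a by simp
qed

lemma limit_set_Lam:
  assumes "x \<in> limit_set"
  shows "ln (M n) \<le> Lam x n" "Lam x n \<le> ln (M n) + real n * ln 2"
proof (induction n)
  case (Suc n)
  have d: "real (N n) \<le> real (digit x n)" "real (digit x n) \<le> 2 * real (N n)" "real (N n) > 0"
    using limit_set_digit[OF assms, of n] N[of n] by auto
  then have "ln (real (N n)) \<le> ln (real (digit x n))" by (subst ln_le_cancel_iff) auto
  moreover have "ln (real (digit x n)) \<le> ln (2 * real (N n))" using d by (subst ln_le_cancel_iff) auto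
  moreover have "ln (M (Suc n)) = ln (M n) + ln (real (N n))" using M_pos[of n] d by (simp add: M_Suc ln_mult)
  moreover have "ln (2 * real (N n)) = ln 2 + ln (real (N n))" using d by (simp add: ln_mult)
  moreover note Suc
  ultimately show "ln (M (Suc n)) \<le> Lam x (Suc n)" "Lam x (Suc n) \<le> ln (M (Suc n)) + real (Suc n) * ln 2"
    unfolding Lam_Suc by (simp_all add: algebra_simps)
qed (simp_all add: M_def Lam_def)

section \<open>Counting cylinders and mass distribution\<close>

text \<open>The proportion \<open>card (hits n V) / M n\<close> stands in for the mass of
  \<open>V\<close> when all words of length \<open>n\<close> have equal weight.\<close>

definition hits :: "nat \<Rightarrow> real set \<Rightarrow> nat list set" where
  "hits n V = {w \<in> W n. foldr g w ` {0..1} \<inter> V \<noteq> {}}"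

lemma finite_hits: "finite (hits n V)"
  using finite_W[of n] by (simp add: hits_def)

text \<open>Cylinders are nested, so dropping the last letter of a word in \<open>hits\<close>
  leaves a word in \<open>hits\<close>, and each prefix has \<open>N n\<close> extensions.\<close>

lemma card_hits_Suc: "real (card (hits (Suc n) V)) \<le> real (card (hits n V)) * real (N n)"
proof -
  have "hits (Suc n) V \<subseteq> (\<lambda>(w, a). w @ [a]) ` (hits n V \<times> {N n..<2 * N n})"
  proof
    fix w assume w: "w \<in> hits (Suc n) V"
    then have "w \<in> W (Suc n)" by (simp add: hits_def)
    then obtain v a where va: "v \<in> W n" "a \<in> {N n..<2 * N n}" "w = v @ [a]" unfolding W_Suc by auto
    obtain y where y: "y \<in> {0..1}" "foldr g w y \<in> V" using w unfolding hits_def by blast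
    have a: "a \<ge> 1" using va(2) N[of n] by auto
    have "g a y \<in> {0..1}" using g_in[OF a y(1)] closed_subset[OF a] by blast
    moreover have "foldr g v (g a y) \<in> V" using va y by simp
    ultimately have "v \<in> hits n V" using va(1) unfolding hits_def by blast
    then show "w \<in> (\<lambda>(w, a). w @ [a]) ` (hits n V \<times> {N n..<2 * N n})" using va by auto
  qed
  then have "card (hits (Suc n) V) \<le> card (hits n V \<times> {N n..<2 * N n})"
    using finite_hits by (intro surj_card_le) auto
  also have "\<dots> = card (hits n V) * N n" by (simp add: card_cartesian_product)
  finally show ?thesis by (metis of_nat_le_iff of_nat_mult)
qed

lemma card_hits_mono: "m \<le> n \<Longrightarrow> real (card (hits n V)) / M n \<le> real (card (hits m V)) / M m"
proof (induction n rule: dec_induct)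
  case (step n)
  have "real (card (hits (Suc n) V)) / M (Suc n) \<le> real (card (hits n V)) / M n"
    using card_hits_Suc[of n V] M_pos[of n] N[of n] by (simp add: M_Suc field_simps)
  then show ?case using step by linarith
qed simp

text \<open>Clip the cylinders meeting the ball to the ball enlarged by \<open>\<delta> n\<close>.
  Each keeps length at least \<open>\<delta> n\<close>, and their interiors are disjoint and lie in
  an interval of length \<open>2 * \<rho> + 2 * \<delta> n\<close>.\<close>

lemma card_hits_le:
  assumes "\<rho> > 0"
  shows "real (card (hits n (ball x \<rho>))) * \<delta> n \<le> 2 * \<rho> + 2 * \<delta> n"
proof -
  let ?d = "\<delta> n" and ?H = "hits n (ball x \<rho>)"
  have "\<exists>p q. foldr g w ` {0..1} = {p..q} \<and> foldr g w ` {0<..<1} = {p<..<q} \<and> \<delta> n \<le> q - p" if "w \<in> W n" for w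
    by (rule W_cylinder_interval[OF that]) blast
  then obtain p q where pq: "\<And>w. w \<in> W n \<Longrightarrow> foldr g w ` {0..1} = {p w..q w} \<and> foldr g w ` {0<..<1} = {p w<..<q w} \<and> \<delta> n \<le> q w - p w"
    by metis
  define Z where "Z w = {max (p w) (x - \<rho> - ?d)<..<min (q w) (x + \<rho> + ?d)}" for w
  have len: "ennreal ?d \<le> emeasure lborel (Z w)" if w: "w \<in> ?H" for w
  proof -
    have wW: "w \<in> W n" using w by (simp add: hits_def)
    have "foldr g w ` {0..1} \<inter> ball x \<rho> \<noteq> {}" using w by (simp add: hits_def)
    then have "{p w..q w} \<inter> ball x \<rho> \<noteq> {}" using pq[OF wW] by simp
    then obtain z where z: "z \<in> {p w..q w}" "z \<in> ball x \<rho>" by blast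
    then have "p w \<le> x + \<rho>" "q w \<ge> x - \<rho>" by (auto simp: dist_real_def)
    then have *: "?d \<le> min (q w) (x + \<rho> + ?d) - max (p w) (x - \<rho> - ?d)"
      using pq[OF wW] assms \<delta>_pos[of n] by (auto simp: min_def max_def)
    then have "max (p w) (x - \<rho> - ?d) \<le> min (q w) (x + \<rho> + ?d)" using \<delta>_pos[of n] by linarith
    then have "emeasure lborel (Z w) = ennreal (min (q w) (x + \<rho> + ?d) - max (p w) (x - \<rho> - ?d))"
      unfolding Z_def by (rule emeasure_lborel_Ioo)
    then show ?thesis using * by (simp add: ennreal_leI)
  qed
  have disjZ: "disjoint_family_on Z ?H"
    unfolding disjoint_family_on_def
  proof (intro ballI impI)
    fix v w assume vw: "v \<in> ?H" "w \<in> ?H" "v \<noteq> w"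
    show "Z v \<inter> Z w = {}"
    proof (rule ccontr)
      assume "Z v \<inter> Z w \<noteq> {}"
      then obtain z where "z \<in> Z v" "z \<in> Z w" by blast
      then have z: "z \<in> {p v<..<q v}" "z \<in> {p w<..<q w}" by (auto simp: Z_def)
      have W: "v \<in> W n" "w \<in> W n" using vw by (auto simp: hits_def)
      then have lens: "length v = n" "length w = n" by (auto simp: W_def)
      obtain y y' where y: "y \<in> {0<..<1}" "z = foldr g v y" "y' \<in> {0<..<1}" "z = foldr g w y'"
        using z pq[OF W(1)] pq[OF W(2)] by (metis imageE)
      \<comment> \<open>The orbit of a point in an open cylinder determines the letters of the word,
        since the intervals are disjoint.\<close>
      have "v ! j = w ! j" if "j < n" for j
      proof (rule ccontr)
        assume ne: "v ! j \<noteq> w ! j"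
        have "(T ^^ j) z \<in> I (v ! j)" "(T ^^ j) z \<in> I (w ! j)"
          using orbit_of_word[OF W_pos[OF W(1)] y(1), of j] orbit_of_word[OF W_pos[OF W(2)] y(3), of j] y lens that by auto
        moreover have "v ! j \<ge> 1" "w ! j \<ge> 1" using W that N[of j] by (auto simp: W_def)
        ultimately show False using disj ne by blast
      qed
      then have "v = w" using lens by (intro nth_equalityI) auto
      then show False using vw by simp
    qed
  qed
  have "ennreal (real (card ?H) * ?d) = (\<Sum>w\<in>?H. ennreal ?d)"
    using \<delta>_pos[of n] by (simp add: ennreal_mult ennreal_of_nat_eq_real_of_nat)
  also have "\<dots> \<le> (\<Sum>w\<in>?H. emeasure lborel (Z w))" by (intro sum_mono len)
  also have "\<dots> = emeasure lborel (\<Union>w\<in>?H. Z w)"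
    by (rule sum_emeasure[OF _ disjZ finite_hits]) (auto simp: Z_def)
  also have "\<dots> \<le> emeasure lborel {x - \<rho> - ?d<..<x + \<rho> + ?d}"
    by (intro emeasure_mono) (auto simp: Z_def)
  also have "\<dots> = ennreal (2 * \<rho> + 2 * ?d)" using assms \<delta>_pos[of n] by simp
  finally show ?thesis using assms \<delta>_pos[of n] by (subst (asm) ennreal_le_iff) auto
qed

text \<open>At the scale \<open>\<delta> (Suc k) \<le> 2 * \<rho> < \<delta> k\<close> the ball
  meets at most 3 cylinders of level \<open>k\<close> and at most
  \<open>6 * \<rho> / \<delta> (Suc k)\<close> of the next level. Both bounds pass to the
  proportions at deeper levels; their geometric mean with weights \<open>1 - s\<close> and
  \<open>s\<close> produces the power of \<open>2 * \<rho>\<close>, and \<open>bound\<close>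
  controls the remaining factor.\<close>

lemma card_hits_power:
  assumes s: "0 < s" "s < 1" and c: "0 < c"
    and bound: "\<And>k. M k powr (s - 1) * (\<delta> (Suc k) * M (Suc k)) powr - s \<le> c"
    and r: "\<rho> > 0"
  shows "\<forall>\<^sub>F n in sequentially. real (card (hits n (ball x \<rho>))) \<le> (3 * c + 1) * (2 * \<rho>) powr s * M n"
proof (cases "2 * \<rho> \<ge> 1")
  \<comment> \<open>For large balls all words are counted; this is what the \<open>+ 1\<close> in
    the constant is for.\<close>
  case True
  have "real (card (hits n (ball x \<rho>))) \<le> (3 * c + 1) * (2 * \<rho>) powr s * M n" for n
  proof -
    have "card (hits n (ball x \<rho>)) \<le> card (W n)" by (intro card_mono finite_W) (auto simp: hits_def)
    then have "real (card (hits n (ball x \<rho>))) \<le> 1 * 1 * M n" using card_W[of n] by simp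
    also have "\<dots> \<le> (3 * c + 1) * (2 * \<rho>) powr s * M n"
      using True s c M_pos[of n] by (intro mult_mono ge_one_powr_ge_zero) auto
    finally show ?thesis .
  qed
  then show ?thesis by simp
next
  case False
  let ?r = "2 * \<rho>" and ?h = "\<lambda>n. real (card (hits n (ball x \<rho>)))"
  obtain m where "(1 / C) ^ m < ?r" using real_arch_pow_inv[of ?r "1 / C"] r C by auto
  then have m: "\<delta> m \<le> ?r" using \<delta>_le[of m] by simp
  \<comment> \<open>The first level with cylinders this short in terms of \<open>\<delta>\<close>.
    It is not 0 because \<open>\<delta> 0 = 1\<close>, and its predecessor violates the
    inequality.\<close>
  define j where "j = (LEAST n. \<delta> n \<le> ?r)"
  have j: "\<delta> j \<le> ?r" unfolding j_def by (rule LeastI[of _ m]) (rule m)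
  then have "j \<noteq> 0" using False \<delta>_0 by (cases "j = 0") auto
  then obtain k where k: "j = Suc k" by (cases j) auto
  have "\<not> \<delta> k \<le> ?r" using not_less_Least[of k "\<lambda>n. \<delta> n \<le> ?r"] k by (simp add: j_def)
  then have k2: "?r < \<delta> k" by simp
  have "?h n \<le> (3 * c + 1) * ?r powr s * M n" if n: "n \<ge> Suc k" for n
  proof -
    have "?h k * \<delta> k \<le> 3 * \<delta> k" using card_hits_le[OF r, of k x] k2 by linarith
    then have "?h k \<le> 3" using \<delta>_pos[of k] by simp
    then have "?h k / M k \<le> 3 / M k" using M_pos[of k] by (intro divide_right_mono) auto
    then have 1: "?h n / M n \<le> 3 * (1 / M k)" using card_hits_mono[of k n "ball x \<rho>"] n by simp
    have "?h (Suc k) * \<delta> (Suc k) \<le> 3 * ?r" using card_hits_le[OF r, of "Suc k" x] j unfolding k by linarith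
    then have "?h (Suc k) \<le> 3 * ?r / \<delta> (Suc k)" using \<delta>_pos[of "Suc k"] by (simp add: field_simps)
    then have "?h (Suc k) / M (Suc k) \<le> 3 * ?r / \<delta> (Suc k) / M (Suc k)"
      using M_pos[of "Suc k"] by (intro divide_right_mono) auto
    then have 2: "?h n / M n \<le> 3 * (?r / (\<delta> (Suc k) * M (Suc k)))"
      using card_hits_mono[of "Suc k" n "ball x \<rho>"] n by (simp add: mult.assoc)
    have "?h n / M n / 3 \<le> (1 / M k) powr (1 - s) * (?r / (\<delta> (Suc k) * M (Suc k))) powr s"
      using 1 2 M_pos[of k] M_pos[of "Suc k"] \<delta>_pos[of "Suc k"] r s by (intro weighted_min_le) auto
    also have "\<dots> = ?r powr s * (M k powr (s - 1) * (\<delta> (Suc k) * M (Suc k)) powr - s)"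
      using M_pos[of k] M_pos[of "Suc k"] \<delta>_pos[of "Suc k"] r
      by (simp add: powr_divide powr_minus powr_diff field_simps)
    also have "\<dots> \<le> ?r powr s * c" by (intro mult_left_mono bound) auto
    finally have "?h n \<le> 3 * (?r powr s * c) * M n" using M_pos[of n] by (simp add: field_simps)
    also have "\<dots> \<le> (3 * c + 1) * ?r powr s * M n"
      using M_pos[of n] by (intro mult_right_mono) (auto simp: algebra_simps)
    finally show ?thesis .
  qed
  then show ?thesis by (auto simp: eventually_sequentially)
qed

text \<open>Mass distribution principle: by \<open>card_hits_power\<close>, finitely many balls with
  a small sum of powers would catch at most half of the words of a deep level, although they cover
  the whole stage.\<close>

lemma limit_set_not_null:
  assumes s: "0 < s" "s < 1" and c: "0 < c"
    and bound: "\<And>k. M k powr (s - 1) * (\<delta> (Suc k) * M (Suc k)) powr - s \<le> c"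
  shows "hausdorff_outer_measure s limit_set \<noteq> 0"
proof
  assume null: "hausdorff_outer_measure s limit_set = 0"
  \<comment> \<open>The powers of the doubled radii will add up to at most \<open>8 * e\<close>, so
    that the final count is \<open>M n / 2\<close>.\<close>
  define e where "e = 1 / (16 * (3 * c + 1))"
  have e: "e > 0" using c by (simp add: e_def)
  from hausdorff_nullD[OF null zero_less_one e] obtain U :: "nat \<Rightarrow> real set" where
    U: "limit_set \<subseteq> (\<Union>i. U i)" "\<And>i. bounded (U i)" "(\<Sum>i. ennreal (diameter (U i) powr s)) < ennreal e" by blast
  \<comment> \<open>Gives a positive radius to sets of diameter 0; the sum of its
    \<open>s\<close>-th powers costs at most another \<open>e\<close>.\<close>
  define \<eta> where "\<eta> i = (e * (1/2) ^ Suc i) powr (1 / s)" for i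
  define \<rho> where "\<rho> i = 2 * max (diameter (U i)) (\<eta> i)" for i
  define V where "V i = ball (SOME x. x \<in> U i) (\<rho> i)" for i
  have eta: "\<eta> i > 0" "\<eta> i powr s = e * (1/2) ^ Suc i" for i
    using e s by (auto simp: \<eta>_def powr_powr)
  have rho: "\<rho> i > 0" for i using eta(1)[of i] by (simp add: \<rho>_def)
  have UV: "U i \<subseteq> V i" for i
  proof
    fix x assume x: "x \<in> U i"
    then have "(SOME x. x \<in> U i) \<in> U i" by (rule someI)
    then have "dist (SOME x. x \<in> U i) x \<le> diameter (U i)"
      using diameter_bounded_bound[OF U(2)[of i]] x by blast
    also have "\<dots> < \<rho> i" using eta(1)[of i] by (auto simp: \<rho>_def max_def)
    finally show "x \<in> V i" by (simp add: V_def)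
  qed
  have d0: "0 \<le> diameter (U i)" for i by (rule diameter_ge_0[OF U(2)])
  have rpow: "(2 * \<rho> i) powr s \<le> 4 * (diameter (U i) powr s + \<eta> i powr s)" for i
  proof -
    have "(2 * \<rho> i) powr s = 4 powr s * max (diameter (U i)) (\<eta> i) powr s"
      using eta(1)[of i] by (simp add: \<rho>_def powr_mult)
    also have "\<dots> \<le> 4 powr 1 * (diameter (U i) powr s + \<eta> i powr s)"
      using s by (intro mult_mono powr_mono) (auto simp: max_def)
    finally show ?thesis by simp
  qed
  have "open (\<Union>i. V i)" unfolding V_def by auto
  moreover have "limit_set \<subseteq> (\<Union>i. V i)" using U(1) UV by blast
  ultimately obtain m where m: "E m \<subseteq> (\<Union>i. V i)" using E_subset_open by blast
  \<comment> \<open>With finitely many balls, the eventual bounds of \<open>card_hits_power\<close>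
    hold from a common level on.\<close>
  obtain F where F: "finite F" "E m \<subseteq> (\<Union>i\<in>F. V i)"
    using compactE_image[OF compact_E[of m], of UNIV V] m by (auto simp: V_def)
  have sumF: "(\<Sum>i\<in>F. (2 * \<rho> i) powr s) \<le> 8 * e"
  proof -
    have "ennreal (\<Sum>i\<in>F. diameter (U i) powr s) = (\<Sum>i\<in>F. ennreal (diameter (U i) powr s))"
      by (rule sum_ennreal[symmetric]) simp
    also have "\<dots> \<le> (\<Sum>i. ennreal (diameter (U i) powr s))"
      using F(1) by (intro sum_le_suminf) auto
    also have "\<dots> \<le> ennreal e" using U(3) by simp
    finally have 1: "(\<Sum>i\<in>F. diameter (U i) powr s) \<le> e" using e by (subst (asm) ennreal_le_iff) auto
    have sums: "(\<lambda>i. e * (1/2) ^ Suc i) sums (e * 1)" by (intro sums_mult power_half_series)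
    have 2: "(\<Sum>i\<in>F. \<eta> i powr s) \<le> e"
      unfolding eta using sum_le_suminf[OF sums_summable[OF sums] F(1)] e sums_unique[OF sums] by simp
    have "(\<Sum>i\<in>F. (2 * \<rho> i) powr s) \<le> (\<Sum>i\<in>F. 4 * (diameter (U i) powr s + \<eta> i powr s))"
      by (intro sum_mono rpow)
    also have "\<dots> = 4 * ((\<Sum>i\<in>F. diameter (U i) powr s) + (\<Sum>i\<in>F. \<eta> i powr s))"
      by (simp add: sum_distrib_left sum.distrib)
    finally show ?thesis using 1 2 by simp
  qed
  have "\<forall>\<^sub>F n in sequentially. \<forall>i\<in>F. real (card (hits n (V i))) \<le> (3 * c + 1) * (2 * \<rho> i) powr s * M n"
    unfolding V_def using F(1) by (intro eventually_ball_finite ballI card_hits_power s c bound rho) auto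
  with eventually_ge_at_top[of m] have "\<forall>\<^sub>F n in sequentially. n \<ge> m \<and>
      (\<forall>i\<in>F. real (card (hits n (V i))) \<le> (3 * c + 1) * (2 * \<rho> i) powr s * M n)"
    by eventually_elim simp
  then obtain n where n: "n \<ge> m" and h: "\<And>i. i \<in> F \<Longrightarrow> real (card (hits n (V i))) \<le> (3 * c + 1) * (2 * \<rho> i) powr s * M n"
    by (auto dest: eventually_happens)
  have "W n \<subseteq> (\<Union>i\<in>F. hits n (V i))"
  proof
    fix w assume w: "w \<in> W n"
    moreover have "(0::real) \<in> {0..1}" by simp
    ultimately have "foldr g w 0 \<in> E n" unfolding E_def by blast
    then have "foldr g w 0 \<in> (\<Union>i\<in>F. V i)" using E_antimono[OF n] F(2) by blast
    then show "w \<in> (\<Union>i\<in>F. hits n (V i))" using w \<open>(0::real) \<in> {0..1}\<close> unfolding hits_def by blast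
  qed
  then have "card (W n) \<le> card (\<Union>i\<in>F. hits n (V i))" using F(1) finite_hits by (intro card_mono) auto
  also have "\<dots> \<le> (\<Sum>i\<in>F. card (hits n (V i)))" by (rule card_UN_le[OF F(1)])
  finally have "M n \<le> (\<Sum>i\<in>F. real (card (hits n (V i))))"
    using card_W[of n] by (metis of_nat_le_iff of_nat_sum)
  also have "\<dots> \<le> (\<Sum>i\<in>F. (3 * c + 1) * (2 * \<rho> i) powr s * M n)" by (intro sum_mono h)
  also have "\<dots> = (3 * c + 1) * M n * (\<Sum>i\<in>F. (2 * \<rho> i) powr s)"
    by (simp add: sum_distrib_left mult_ac)
  also have "\<dots> \<le> (3 * c + 1) * M n * (8 * e)" using c M_pos[of n] by (intro mult_left_mono sumF) auto
  also have "\<dots> = M n / 2" using c by (simp add: e_def field_simps)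
  finally show False using M_pos[of n] by simp
qed

end

section \<open>Lower bounds for the dimension\<close>

lemma eventually_le_imp_bounded:
  fixes u :: "nat \<Rightarrow> real"
  assumes "\<forall>\<^sub>F n in sequentially. u n \<le> c"
  shows "\<exists>d>0. \<forall>n. u n \<le> d"
proof -
  obtain m where m: "\<And>n. n \<ge> m \<Longrightarrow> u n \<le> c" using assms by (auto simp: eventually_sequentially)
  define d where "d = \<bar>c\<bar> + (\<Sum>n<m. \<bar>u n\<bar>) + 1"
  have s: "(\<Sum>n<m. \<bar>u n\<bar>) \<ge> 0" by (intro sum_nonneg) auto
  have "u n \<le> d" for n
  proof (cases "n < m")
    case True
    then have "\<bar>u n\<bar> \<le> (\<Sum>n<m. \<bar>u n\<bar>)" by (intro member_le_sum) auto
    then show ?thesis by (simp add: d_def)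
  next
    case False
    then show ?thesis using m[of n] s unfolding d_def by linarith
  qed
  moreover have "d > 0" using s unfolding d_def by linarith
  ultimately show ?thesis by blast
qed

context renyi_scaling
begin

text \<open>A single Cantor set serves all \<open>s\<close> and \<open>b\<close>. The logarithm of
  \<open>N n\<close> is within a constant of \<open>a * (\<phi> (Suc n) - \<phi> n)\<close> with
  \<open>a = \<alpha> / \<gamma>\<close>, so the increments telescope to \<open>a * \<phi> n\<close>
  with an error of order \<open>n\<close>.\<close>

lemma lower_construction:
  assumes al: "\<alpha> > 0" and eq: "equivalent_to_increasing \<psi>"
  shows "\<exists>L. L \<subseteq> level_set I T \<psi> (ereal \<alpha>) \<and> L \<noteq> {} \<and>
           (\<forall>s b. 0 < s \<longrightarrow> 0 < b \<longrightarrow> (\<forall>\<^sub>F n in sequentially. \<psi> (n + 1) \<le> b * \<psi> n) \<longrightarrow>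
              s * (1 + b * (\<gamma> - 1)) < 1 \<longrightarrow> hausdorff_outer_measure s L \<noteq> 0)"
proof -
  from eq obtain \<phi>' where \<phi>': "\<And>n. n \<ge> 1 \<Longrightarrow> \<phi>' n > 0" "\<And>n. n \<ge> 1 \<Longrightarrow> \<phi>' (n + 1) \<ge> \<phi>' n"
    "(\<lambda>n. \<psi> n / \<phi>' n) \<longlonglongrightarrow> 1" unfolding equivalent_to_increasing_def by blast
  \<comment> \<open>The value 0 at 0 makes the increments sum exactly to
    \<open>\<phi> n\<close>.\<close>
  define \<phi> where "\<phi> n = (if n = 0 then 0 else \<phi>' n)" for n
  have phi: "\<phi> n \<le> \<phi> (Suc n)" for n
    using \<phi>'(1)[of "Suc n"] \<phi>'(2)[of n] by (auto simp: \<phi>_def)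
  have "\<forall>\<^sub>F n in sequentially. \<psi> n / \<phi>' n = \<psi> n / \<phi> n"
    using eventually_gt_at_top[of 0] by eventually_elim (simp add: \<phi>_def)
  then have "(\<lambda>n. \<psi> n / \<phi> n) \<longlonglongrightarrow> 1" using \<phi>'(3) by (rule Lim_transform_eventually[rotated])
  then have "(\<lambda>n. inverse (\<psi> n / \<phi> n)) \<longlonglongrightarrow> inverse 1" by (intro tendsto_inverse) auto
  then have lim: "(\<lambda>n. \<phi> n / \<psi> n) \<longlonglongrightarrow> 1" by simp
  define a where "a = \<alpha> / \<gamma>"
  have a: "a > 0" using al gamma by (simp add: a_def)
  \<comment> \<open>As \<open>\<phi>\<close> is increasing, the exponential is at least 1, so the
    \<open>+ 1\<close> yields \<open>N n \<ge> 2\<close> at the cost of a factor of at most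
    3.\<close>
  define N where "N n = nat \<lceil>exp (a * (\<phi> (Suc n) - \<phi> n))\<rceil> + 1" for n
  have NN: "exp (a * (\<phi> (Suc n) - \<phi> n)) \<le> real (N n)" "real (N n) \<le> 3 * exp (a * (\<phi> (Suc n) - \<phi> n))" "N n \<ge> 2" for n
  proof -
    let ?t = "exp (a * (\<phi> (Suc n) - \<phi> n))"
    have t: "?t \<ge> 1" using phi[of n] a by simp
    have "real (nat \<lceil>?t\<rceil>) = of_int \<lceil>?t\<rceil>" using t by (intro of_nat_nat) linarith
    then have "?t \<le> real (nat \<lceil>?t\<rceil>)" "real (nat \<lceil>?t\<rceil>) \<le> ?t + 1" by linarith+
    then show "?t \<le> real (N n)" "real (N n) \<le> 3 * ?t" "N n \<ge> 2" using t unfolding N_def by linarith+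
  qed
  interpret cantor_construction I T S l r \<gamma> C N
    by unfold_locales (rule NN(3))
  have lnN: "a * (\<phi> (Suc n) - \<phi> n) \<le> ln (real (N n))" "ln (real (N n)) \<le> ln 3 + a * (\<phi> (Suc n) - \<phi> n)" for n
  proof -
    have p: "real (N n) > 0" using NN(3)[of n] by simp
    show "a * (\<phi> (Suc n) - \<phi> n) \<le> ln (real (N n))" using NN(1)[of n] p by (subst ln_ge_iff) auto
    have "ln (real (N n)) \<le> ln (3 * exp (a * (\<phi> (Suc n) - \<phi> n)))" using NN(2)[of n] p by (subst ln_le_cancel_iff) auto
    then show "ln (real (N n)) \<le> ln 3 + a * (\<phi> (Suc n) - \<phi> n)" by (simp add: ln_mult)
  qed
  have lnM: "a * \<phi> n \<le> ln (M n) \<and> ln (M n) \<le> a * \<phi> n + real n * ln 3" for n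
  proof (induction n)
    case 0
    then show ?case by (simp add: M_def \<phi>_def)
  next
    case (Suc n)
    have "ln (M (Suc n)) = ln (M n) + ln (real (N n))" using M_pos[of n] NN(3)[of n] by (simp add: M_Suc ln_mult)
    then show ?case using Suc lnN[of n] by (simp add: algebra_simps)
  qed
  have squeeze: "(\<lambda>n. X n / \<psi> n) \<longlonglongrightarrow> a" if X: "\<And>n. a * \<phi> n \<le> X n" "\<And>n. X n \<le> a * \<phi> n + d * real n" for X d
  proof (rule tendsto_sandwich)
    show "(\<lambda>n. a * (\<phi> n / \<psi> n)) \<longlonglongrightarrow> a" using tendsto_mult_left[OF lim, of a] by simp
    have "(\<lambda>n. a * (\<phi> n / \<psi> n) + d * real n / \<psi> n) \<longlonglongrightarrow> a * 1 + 0"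
      by (intro tendsto_intros lim linear_over_scale_tendsto_0 psi_lim)
    then show "(\<lambda>n. a * (\<phi> n / \<psi> n) + d * real n / \<psi> n) \<longlonglongrightarrow> a" by simp
    show "\<forall>\<^sub>F n in sequentially. a * (\<phi> n / \<psi> n) \<le> X n / \<psi> n"
      using psi_pos by eventually_elim (use X(1) in \<open>simp add: divide_right_mono\<close>)
    show "\<forall>\<^sub>F n in sequentially. X n / \<psi> n \<le> a * (\<phi> n / \<psi> n) + d * real n / \<psi> n"
      using psi_pos by eventually_elim (use X(2) in \<open>simp add: divide_right_mono add_divide_distrib[symmetric]\<close>)
  qed
  have sub: "limit_set \<subseteq> level_set I T \<psi> (ereal \<alpha>)"
  proof
    fix x assume x: "x \<in> limit_set"
    have "a * \<phi> n \<le> Lam x n" "Lam x n \<le> a * \<phi> n + (ln 3 + ln 2) * real n" for n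
      using limit_set_Lam[OF x, of n] lnM[of n] by (auto simp: algebra_simps)
    then have "(\<lambda>n. Lam x n / \<psi> n) \<longlonglongrightarrow> a" by (rule squeeze)
    from tendsto_mult_left[OF this, of \<gamma>] have "(\<lambda>n. \<gamma> * Lam x n / \<psi> n) \<longlonglongrightarrow> \<alpha>"
      using gamma by (simp add: a_def)
    then show "x \<in> level_set I T \<psi> (ereal \<alpha>)"
      using limit_set_good[OF x] by (simp add: level_set_real[OF psi_lim])
  qed
  have "hausdorff_outer_measure s limit_set \<noteq> 0"
    if s: "0 < s" and b: "0 < b" and psib: "\<forall>\<^sub>F n in sequentially. \<psi> (n + 1) \<le> b * \<psi> n"
      and sb: "s * (1 + b * (\<gamma> - 1)) < 1" for s b
  proof -
    have "s * 1 \<le> s * (1 + b * (\<gamma> - 1))" using s b gamma by (intro mult_left_mono) auto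
    then have s1: "s < 1" using sb by simp
    define D where "D = s * (ln C + \<gamma> * ln 2)"
    have D: "D \<ge> 0" using s C gamma by (simp add: D_def)
    \<comment> \<open>The quantity that \<open>limit_set_not_null\<close> wants bounded. The upper
      bound found for \<open>ln (u k) / \<psi> k\<close> tends to
      \<open>(s * (1 + b * (\<gamma> - 1)) - 1) * a < 0\<close>.\<close>
    define u where "u k = M k powr (s - 1) * (\<delta> (Suc k) * M (Suc k)) powr - s" for k
    have lnu: "ln (u k) = (s - 1) * ln (M k) + s * (\<gamma> - 1) * ln (M (Suc k)) + D * real (Suc k)" for k
    proof -
      have ld: "ln (\<delta> (Suc k)) = - \<gamma> * (real (Suc k) * ln 2 + ln (M (Suc k))) - real (Suc k) * ln C"
        unfolding \<delta>_def using M_pos[of "Suc k"] C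
        by (simp add: ln_div ln_powr ln_mult ln_realpow del: power_Suc of_nat_Suc)
      have "ln (u k) = (s - 1) * ln (M k) + (- s) * (ln (\<delta> (Suc k)) + ln (M (Suc k)))"
        unfolding u_def using M_pos[of k] M_pos[of "Suc k"] \<delta>_pos[of "Suc k"]
        by (simp add: ln_mult ln_powr)
      then show ?thesis unfolding ld D_def by (simp add: algebra_simps)
    qed
    let ?y = "\<lambda>k. ln (M k) / \<psi> k"
    have y: "?y \<longlonglongrightarrow> a" by (rule squeeze[of _ "ln 3"]) (use lnM in \<open>auto simp: mult.commute\<close>)
    \<comment> \<open>The factor \<open>b\<close> replaces \<open>\<psi> (Suc k) / \<psi> k\<close>,
      and \<open>2 * D\<close> comes from \<open>Suc k \<le> 2 * k\<close>.\<close>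
    have "(\<lambda>k. (s - 1) * ?y k + s * (\<gamma> - 1) * b * ?y (Suc k) + (2 * D) * real k / \<psi> k)
        \<longlonglongrightarrow> (s - 1) * a + s * (\<gamma> - 1) * b * a + 0"
      by (intro tendsto_intros y LIMSEQ_Suc linear_over_scale_tendsto_0 psi_lim)
    moreover have "(s - 1) * a + s * (\<gamma> - 1) * b * a + 0 < 0"
    proof -
      have "(s * (1 + b * (\<gamma> - 1)) - 1) * a < 0" using sb a by (intro mult_neg_pos) auto
      then show ?thesis by (simp add: algebra_simps)
    qed
    ultimately have ev: "\<forall>\<^sub>F k in sequentially. (s - 1) * ?y k + s * (\<gamma> - 1) * b * ?y (Suc k) + (2 * D) * real k / \<psi> k < 0"
      by (rule order_tendstoD(2))
    have pS: "\<forall>\<^sub>F n in sequentially. 0 < \<psi> (Suc n)" by (rule eventually_sequentially_Suc[THEN iffD2, OF psi_pos])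
    have "\<forall>\<^sub>F k in sequentially. u k \<le> 1"
      using ev psib psi_pos pS eventually_ge_at_top[of 1]
    proof eventually_elim
      case (elim k)
      have u0: "u k > 0" unfolding u_def using M_pos[of k] M_pos[of "Suc k"] \<delta>_pos[of "Suc k"] by simp
      have y0: "?y (Suc k) \<ge> 0" using elim M_ge_1[of "Suc k"] by simp
      have "ln (M (Suc k)) = ?y (Suc k) * \<psi> (Suc k)" using elim by simp
      also have "\<dots> \<le> ?y (Suc k) * (b * \<psi> k)" using elim y0 by (intro mult_left_mono) auto
      finally have "s * (\<gamma> - 1) * ln (M (Suc k)) \<le> s * (\<gamma> - 1) * (?y (Suc k) * (b * \<psi> k))"
        using s gamma by (intro mult_left_mono) auto
      moreover have "D * real (Suc k) \<le> D * (2 * real k)" using elim D by (intro mult_left_mono) auto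
      moreover have "(s - 1) * ln (M k) = (s - 1) * ?y k * \<psi> k" "D * (2 * real k) = (2 * D) * real k / \<psi> k * \<psi> k"
        using elim by simp_all
      moreover have dist: "((s - 1) * y1 + s * (\<gamma> - 1) * b * y2 + z) * \<psi> k =
          (s - 1) * y1 * \<psi> k + s * (\<gamma> - 1) * (y2 * (b * \<psi> k)) + z * \<psi> k" for y1 y2 z
        by (simp add: algebra_simps)
      ultimately have "ln (u k) \<le> ((s - 1) * ?y k + s * (\<gamma> - 1) * b * ?y (Suc k) + (2 * D) * real k / \<psi> k) * \<psi> k"
        unfolding lnu dist by linarith
      also have "\<dots> \<le> 0" using elim by (intro mult_nonpos_nonneg) auto
      finally show ?case using u0 by simp
    qed
    from eventually_le_imp_bounded[OF this] obtain c where "c > 0" "\<And>k. u k \<le> c" by blast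
    then show ?thesis unfolding u_def by (intro limit_set_not_null s s1)
  qed
  then show ?thesis using sub limit_set_nonempty by (intro exI[of _ limit_set]) blast
qed

lemma dim_lower_real:
  assumes al: "\<alpha> > 0" and eq: "equivalent_to_increasing \<psi>"
  shows "1 / (ereal (\<gamma> - 1) * growth_beta \<psi> + 1) \<le> hausdorff_dim (level_set I T \<psi> (ereal \<alpha>))"
proof (rule hausdorff_dim_ge)
  fix s assume s: "0 < s" "ereal s < 1 / (ereal (\<gamma> - 1) * growth_beta \<psi> + 1)"
  from dim_formula_greater[OF gamma growth_beta_ge_1 s] obtain b where
    b: "growth_beta \<psi> < ereal b" "s * (1 + b * (\<gamma> - 1)) < 1" by blast
  have "1 < ereal b" using growth_beta_ge_1 b(1) by (rule le_less_trans)
  then have "b > 0" by simp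
  have "\<forall>\<^sub>F n in sequentially. \<psi> (n + 1) / \<psi> n < b"
    using b(1) unfolding growth_beta_def by (rule limsup_less_eventually)
  with psi_pos have ev: "\<forall>\<^sub>F n in sequentially. \<psi> (n + 1) \<le> b * \<psi> n"
    by eventually_elim (simp add: field_simps)
  from lower_construction[OF al eq] obtain L where "L \<subseteq> level_set I T \<psi> (ereal \<alpha>)"
    "hausdorff_outer_measure s L \<noteq> 0" using s(1) \<open>b > 0\<close> ev b(2) by blast
  then show "hausdorff_outer_measure s (level_set I T \<psi> (ereal \<alpha>)) \<noteq> 0"
    using hausdorff_null_subset[OF _ _ s(1)] by blast
qed

lemma equivalent_imp_nonempty:
  assumes "\<alpha> > 0" "equivalent_to_increasing \<psi>"
  shows "level_set I T \<psi> (ereal \<alpha>) \<noteq> {}"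
  using lower_construction[OF assms] by blast

text \<open>Compare with the scale \<open>b ^ n\<close> for \<open>b\<close> above
  \<open>growth_B \<psi>\<close>: it dominates \<open>\<psi>\<close>, so its level set at 1 lies in
  the level set of \<open>\<psi>\<close> at infinity, and its growth ratio is exactly
  \<open>b\<close>.\<close>

lemma dim_lower_infinite:
  "1 / (ereal (\<gamma> - 1) * growth_B \<psi> + 1) \<le> hausdorff_dim (level_set I T \<psi> \<infinity>)"
proof (rule hausdorff_dim_ge)
  fix s assume s: "0 < s" "ereal s < 1 / (ereal (\<gamma> - 1) * growth_B \<psi> + 1)"
  from dim_formula_greater[OF gamma growth_B_ge_1 s] obtain b where
    b: "growth_B \<psi> < ereal b" "s * (1 + b * (\<gamma> - 1)) < 1" by blast
  \<comment> \<open>Eventually \<open>\<psi> n \<le> b' ^ n\<close>, so the gap below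
    \<open>b\<close> makes \<open>b ^ n / \<psi> n\<close> at least \<open>(b / b') ^ n\<close>,
    which diverges.\<close>
  obtain b' where b': "growth_B \<psi> < ereal b'" "b' < b" using ereal_dense2[OF b(1)] by auto
  have "1 < ereal b'" using growth_B_ge_1 b'(1) by (rule le_less_trans)
  then have b1: "b' > 1" "b > 1" using b' by (auto simp: one_ereal_def)
  define \<theta> where "\<theta> n = b ^ n" for n :: nat
  have theta_pos: "\<theta> n > 0" for n using b1 by (simp add: \<theta>_def)
  have "(\<lambda>n. real n / b ^ n) \<longlonglongrightarrow> 0"
    using powser_times_n_limit_0[of "1 / b"] b1 by (simp add: power_divide)
  then have theta: "filterlim (\<lambda>n. \<theta> n / real n) at_top sequentially"
  proof -
    assume "(\<lambda>n. real n / b ^ n) \<longlonglongrightarrow> 0"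
    then have "filterlim (\<lambda>n. inverse (real n / b ^ n)) at_top sequentially"
    proof (rule filterlim_inverse_at_top)
      show "\<forall>\<^sub>F n in sequentially. 0 < real n / b ^ n"
        using eventually_gt_at_top[of 0] by eventually_elim (use b1 in simp)
    qed
    then show ?thesis by (simp add: \<theta>_def)
  qed
  interpret theta: renyi_scaling I T S l r \<gamma> C \<theta>
    by unfold_locales (rule theta)
  have inc: "equivalent_to_increasing \<theta>"
    unfolding equivalent_to_increasing_def
  proof (intro exI[of _ \<theta>] conjI allI impI)
    show "\<theta> n \<le> \<theta> (n + 1)" for n using b1 by (simp add: \<theta>_def)
    show "(\<lambda>n. \<theta> n / \<theta> n) \<longlonglongrightarrow> 1" using theta_pos by (simp add: less_imp_neq[symmetric])
  qed (rule theta_pos)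
  have step: "\<forall>\<^sub>F n in sequentially. \<theta> (n + 1) \<le> b * \<theta> n" by (simp add: \<theta>_def)
  have "b > 0" using b1 by simp
  from theta.lower_construction[OF zero_less_one inc] obtain L where
    L: "L \<subseteq> level_set I T \<theta> (ereal 1)" "hausdorff_outer_measure s L \<noteq> 0"
    using s(1) \<open>b > 0\<close> step b(2) by blast
  have "level_set I T \<theta> (ereal 1) \<subseteq> level_set I T \<psi> \<infinity>"
  proof
    fix x assume "x \<in> level_set I T \<theta> (ereal 1)"
    then have x: "x \<in> good" and lim: "(\<lambda>n. \<gamma> * Lam x n / \<theta> n) \<longlonglongrightarrow> 1"
      unfolding level_set_real[OF theta] by auto
    have "\<forall>\<^sub>F n in sequentially. root n (\<psi> n) < b'"
      using b'(1) unfolding growth_B_def by (rule limsup_less_eventually)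
    with psi_pos eventually_gt_at_top[of 0] have le: "\<forall>\<^sub>F n in sequentially. (b / b') ^ n \<le> \<theta> n / \<psi> n"
    proof eventually_elim
      case (elim n)
      have "\<psi> n = root n (\<psi> n) ^ n" using elim by (simp add: real_root_pow_pos)
      also have "\<dots> \<le> b' ^ n" using elim by (intro power_mono) auto
      finally have "\<theta> n / b' ^ n \<le> \<theta> n / \<psi> n"
        using elim theta_pos[of n] b1 by (intro divide_left_mono) auto
      then show ?case by (simp add: \<theta>_def power_divide)
    qed
    have "filterlim (\<lambda>n. (b / b') ^ n) at_top sequentially"
      unfolding filterlim_at_top
    proof
      fix Z
      obtain m where m: "Z < (b / b') ^ m" using real_arch_pow[of "b / b'"] b1 b' by auto
      have "(b / b') ^ m \<le> (b / b') ^ n" if "n \<ge> m" for n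
        using that b1 b' by (intro power_increasing) auto
      then show "\<forall>\<^sub>F n in sequentially. Z \<le> (b / b') ^ n"
        using m by (auto simp: eventually_sequentially intro!: exI[of _ m] order_trans[OF less_imp_le[OF m]])
    qed
    then have top: "filterlim (\<lambda>n. \<theta> n / \<psi> n) at_top sequentially" using le by (rule filterlim_at_top_mono)
    have "filterlim (\<lambda>n. \<gamma> * Lam x n / \<theta> n * (\<theta> n / \<psi> n)) at_top sequentially"
      by (rule filterlim_tendsto_pos_mult_at_top[OF lim _ top]) simp
    moreover have "\<gamma> * Lam x n / \<theta> n * (\<theta> n / \<psi> n) = \<gamma> * Lam x n / \<psi> n" for n
      using theta_pos[of n] by simp
    ultimately have "filterlim (\<lambda>n. \<gamma> * Lam x n / \<psi> n) at_top sequentially" by (simp only:)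
    then show "x \<in> level_set I T \<psi> \<infinity>" using x by (simp add: level_set_infinite[OF psi_lim])
  qed
  then show "hausdorff_outer_measure s (level_set I T \<psi> \<infinity>) \<noteq> 0"
    using L hausdorff_null_subset[OF _ _ s(1)] by blast
qed

end

theorem theorem1:
  fixes I :: "nat \<Rightarrow> real set" and T :: "real \<Rightarrow> real" and \<gamma> :: real and \<psi> :: "nat \<Rightarrow> real"
  assumes "markov_renyi I T \<gamma>"
    and "\<And>n. n \<ge> 1 \<Longrightarrow> \<psi> n > 0"
    and "filterlim (\<lambda>n. \<psi> n / real n) at_top sequentially"
  shows
    "(iterates_defined_on_repeller I T \<longrightarrow>
        level_set I T \<psi> 0 \<in> sets lebesgue \<and>
        emeasure lebesgue (level_set I T \<psi> 0) = (\<Sum>n. ennreal (diameter (I (Suc n)))) \<and>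
        hausdorff_dim (level_set I T \<psi> 0) = 1)
     \<and> (\<forall>\<alpha>::real. 0 < \<alpha> \<longrightarrow>
        (level_set I T \<psi> (ereal \<alpha>) \<noteq> {} \<longleftrightarrow> equivalent_to_increasing \<psi>) \<and>
        (level_set I T \<psi> (ereal \<alpha>) \<noteq> {} \<longrightarrow>
          hausdorff_dim (level_set I T \<psi> (ereal \<alpha>)) =
            1 / (ereal (\<gamma> - 1) * growth_beta \<psi> + 1)))
     \<and> hausdorff_dim (level_set I T \<psi> \<infinity>) = 1 / (ereal (\<gamma> - 1) * growth_B \<psi> + 1)"
proof -
  obtain S l r C where "renyi_branches I T S l r \<gamma> C"
    using markov_renyi_branches[OF assms(1)] by blast
  then interpret renyi_branches I T S l r \<gamma> C .
  interpret renyi_scaling I T S l r \<gamma> C \<psi>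
    by unfold_locales (rule assms(3))
  show ?thesis
  proof (intro conjI impI allI)
    assume "iterates_defined_on_repeller I T"
    from level_set_zero[OF this] show "level_set I T \<psi> 0 \<in> sets lebesgue"
      "emeasure lebesgue (level_set I T \<psi> 0) = (\<Sum>n. ennreal (diameter (I (Suc n))))"
      "hausdorff_dim (level_set I T \<psi> 0) = 1" by blast+
  next
    fix \<alpha> :: real assume al: "0 < \<alpha>"
    show iff: "level_set I T \<psi> (ereal \<alpha>) \<noteq> {} \<longleftrightarrow> equivalent_to_increasing \<psi>"
      using nonempty_imp_equivalent[OF al] equivalent_imp_nonempty[OF al] by blast
    assume "level_set I T \<psi> (ereal \<alpha>) \<noteq> {}"
    then have "equivalent_to_increasing \<psi>" by (rule nonempty_imp_equivalent[OF al])
    then show "hausdorff_dim (level_set I T \<psi> (ereal \<alpha>)) = 1 / (ereal (\<gamma> - 1) * growth_beta \<psi> + 1)"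
      by (intro antisym dim_upper_real dim_lower_real al)
  next
    show "hausdorff_dim (level_set I T \<psi> \<infinity>) = 1 / (ereal (\<gamma> - 1) * growth_B \<psi> + 1)"
      by (intro antisym dim_upper_infinite dim_lower_infinite)
  qed
qed

end
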